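(* Let $m,n \geq 1$ be integers, let $r \in \mathbb{Z}/n\mathbb{Z}$, and let $\lambda = (\lambda_1 \geq \cdots \geq \lambda_m \geq 0)$ be a partition with at most $m$ parts. Let $\delta = (m-1, m-2, \ldots, 1, 0)$. Then the loop Schur function $s_\lambda^{(r)}$ is the ratio of loop alternants $$s_{\lambda}^{(r)}(\mathbf{x}_1, \ldots, \mathbf{x}_m) = \frac{a_{\lambda + \delta}^{(r)}}{a_{\delta}^{(r)}}$$ in the field $\mathbb{Q}(x_i^{(j)})$.
   Context: Fix integers $m,n\ge 1$. For $i\in\{1,\dots,m\}$ and $j\in\mathbb{Z}/n\mathbb{Z}$ let $x_i^{(j)}$ be an indeterminate, and let $\mathbb{Q}(x_i^{(j)})$ be the field of rational functions in these $mn$ indeterminates. All superscripts in parentheses are read modulo $n$. Write $\mathbf{x}_i=(x_i^{(1)},\dots,x_i^{(n)})$. **Loop Schur functions.** Boxes of a Young diagram are indexed by (row, column) $=(i,j)$ with $i,j\ge1$. A semistandard tableau $T$ of shape $\lambda$ is a filling of the Young diagram of $\lambda$ with positive integers that is weakly increasing along rows and strictly increasing down columns. For $r\in\mathbb{Z}/n\mathbb{Z}$ define $$s_\lambda^{(r)}(\mathbf{x}_1,\dots,\mathbf{x}_m)=\sum_T\ \prod_{(i,j)\in\lambda} x_{T(i,j)}^{(r+i-j)},$$ the sum being over semistandard tableaux $T$ of shape $\lambda$ with entries in $\{1,\dots,m\}$; $s_\emptyset^{(r)}=1$. **Birational $S_m$ action.** For $r\in\mathbb{Z}/n\mathbb{Z}$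 and $\mathbf{x}=(x^{(1)},\dots,x^{(n)})$, $\mathbf{y}=(y^{(1)},\dots,y^{(n)})$ set $$\kappa^{(r)}(\mathbf{x},\mathbf{y})=\sum_{s=0}^{n-1} x^{(r-1)}x^{(r-2)}\cdots x^{(r-s)}\; y^{(r-s-1)}y^{(r-s-2)}\cdots y^{(r-n+1)}$$ (so each term is a product of $n-1$ variables with colors $r-1,r-2,\dots,r-n+1$, the first $s$ of them being $x$'s and the rest $y$'s). For $i=1,\dots,m-1$ let $s_i:\mathbb{Q}(x_i^{(j)})\to\mathbb{Q}(x_i^{(j)})$ be the $\mathbb{Q}$-algebra homomorphism fixing $x_k^{(j)}$ for $k\ne i,i+1$ and with $$s_i(x_i^{(j)})=x_{i+1}^{(j+1)}\frac{\kappa^{(j+1)}(\mathbf{x}_i,\mathbf{x}_{i+1})}{\kappa^{(j)}(\mathbf{x}_i,\mathbf{x}_{i+1})},\qquad s_i(x_{i+1}^{(j)})=x_i^{(j-1)}\frac{\kappa^{(j-1)}(\mathbf{x}_i,\mathbf{x}_{i+1})}{\kappa^{(j)}(\mathbf{x}_i,\mathbf{x}_{i+1})}.$$ It is known that the maps $s_i$ satisfy the relations of the adjacent transpositions in the symmetric group $S_m$, so they generate an action of $S_m$ on $\mathbb{Q}(x_i^{(j)})$ (with $s_i$ the action of the transposition $(i\ i+1)$, and products in $S_m$ acting by composition of maps). Let $t_{a,b}$ denote the action of the transposition swapping $a$ and $b$; $t_{m,m}$ is the identity. **Loop alternants.** For a sequence $\alpha=(\alpha_1,\dots,\alpha_m)$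 of non-negative integers and $r\in\mathbb{Z}/n\mathbb{Z}$, let $A_\alpha^{(r)}$ be the $m\times m$ matrix with entries $$(A_\alpha^{(r)})_{ij}=t_{j,m}\bigl(x_m^{(r+m-1)}x_m^{(r+m-2)}\cdots x_m^{(r+m-\alpha_i)}\bigr)$$ (a product of $\alpha_i$ factors, equal to $1$ if $\alpha_i=0$), and let $a_\alpha^{(r)}=\det(A_\alpha^{(r)})$. Addition $\lambda+\delta$ is componentwise. *)

theory Defs
  imports
    "Jordan_Normal_Form.Determinant"
    "HOL-Combinatorics.Transposition"
    "HOL-Library.Poly_Mapping"
    "HOL-Library.Nat_Bijection"
    "HOL-Library.FuncSet"
begin

text \<open>
  Rational functions over the rationals in countably many indeterminates.  The indeterminates are
  indexed by pairs (row, colour) of naturals, coded as naturals by \<^const>\<open>prod_encode\<close>, so that the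
  type does not depend on \<open>m\<close> and \<open>n\<close>; the field generated by the \<open>m n\<close> indeterminates with row in
  \<open>{1..m}\<close> and colour in \<open>{0..<n}\<close> is a subfield.
\<close>

type_synonym ratfun = "((nat \<Rightarrow>\<^sub>0 nat) \<Rightarrow>\<^sub>0 rat) fract"

definition rat_const :: "rat \<Rightarrow> ratfun" where
  "rat_const c = to_fract (Poly_Mapping.single 0 c)"

definition indet :: "nat \<Rightarrow> nat \<Rightarrow> ratfun" where
  "indet i c = to_fract (Poly_Mapping.single (Poly_Mapping.single (prod_encode (i, c)) 1) 1)"

text \<open>Residue classes modulo \<open>n\<close> are given by arbitrary integer representatives.\<close>

definition loop_var :: "nat \<Rightarrow> nat \<Rightarrow> int \<Rightarrow> ratfun" where
  "loop_var n i j = indet i (nat (j mod int n))"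

definition young_diagram :: "nat \<Rightarrow> (nat \<Rightarrow> nat) \<Rightarrow> (nat \<times> nat) set" where
  "young_diagram m lam = {(i, j). 1 \<le> i \<and> i \<le> m \<and> 1 \<le> j \<and> j \<le> lam i}"

definition ssyt :: "nat \<Rightarrow> (nat \<Rightarrow> nat) \<Rightarrow> (nat \<times> nat \<Rightarrow> nat) set" where
  "ssyt m lam = {T \<in> young_diagram m lam \<rightarrow>\<^sub>E {1..m}.
     (\<forall>i j j'. (i, j) \<in> young_diagram m lam \<longrightarrow> (i, j') \<in> young_diagram m lam \<longrightarrow>
        j < j' \<longrightarrow> T (i, j) \<le> T (i, j')) \<and>
     (\<forall>i i' j. (i, j) \<in> young_diagram m lam \<longrightarrow> (i', j) \<in> young_diagram m lam \<longrightarrow>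
        i < i' \<longrightarrow> T (i, j) < T (i', j))}"

definition loop_schur :: "nat \<Rightarrow> nat \<Rightarrow> (nat \<Rightarrow> nat) \<Rightarrow> int \<Rightarrow> ratfun" where
  "loop_schur m n lam r =
     (\<Sum>T\<in>ssyt m lam. \<Prod>(i, j)\<in>young_diagram m lam. loop_var n (T (i, j)) (r + int i - int j))"

definition kappa :: "nat \<Rightarrow> int \<Rightarrow> (int \<Rightarrow> 'a) \<Rightarrow> (int \<Rightarrow> 'a) \<Rightarrow> 'a::comm_ring_1" where
  "kappa n r x y =
     (\<Sum>s = 0..n - 1. (\<Prod>k = 1..s. x (r - int k)) * (\<Prod>k = s + 1..n - 1. y (r - int k)))"

definition rat_alg_hom :: "(ratfun \<Rightarrow> ratfun) \<Rightarrow> bool" where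
  "rat_alg_hom f \<longleftrightarrow> comm_ring_hom f \<and> (\<forall>c. f (rat_const c) = rat_const c)"

text \<open>
  The generator \<open>s\<^sub>i\<close>.  The indeterminates with colour \<open>c \<ge> n\<close>, which are not of the form
  \<^term>\<open>loop_var n k j\<close>, are fixed as well, so that the homomorphism is uniquely determined.
\<close>

definition s_gen :: "nat \<Rightarrow> nat \<Rightarrow> ratfun \<Rightarrow> ratfun" where
  "s_gen n i = (THE f. rat_alg_hom f \<and>
     (\<forall>k c. (k \<noteq> i \<and> k \<noteq> i + 1) \<or> c \<ge> n \<longrightarrow> f (indet k c) = indet k c) \<and>
     (\<forall>j. f (loop_var n i j) =
        loop_var n (i + 1) (j + 1) * kappa n (j + 1) (loop_var n i) (loop_var n (i + 1))
          / kappa n j (loop_var n i) (loop_var n (i + 1))) \<and>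
     (\<forall>j. f (loop_var n (i + 1) j) =
        loop_var n i (j - 1) * kappa n (j - 1) (loop_var n i) (loop_var n (i + 1))
          / kappa n j (loop_var n i) (loop_var n (i + 1))))"

text \<open>
  The action of a permutation of \<open>{1..m}\<close>: write it as a product of adjacent transpositions
  \<open>(i i+1)\<close> and compose the corresponding \<open>s\<^sub>i\<close>.  The result does not depend on the chosen word,
  since the \<open>s\<^sub>i\<close> satisfy the relations of the adjacent transpositions.
\<close>

definition adj_word_perm :: "nat list \<Rightarrow> nat \<Rightarrow> nat" where
  "adj_word_perm w = foldr (\<lambda>i p. Transposition.transpose i (i + 1) \<circ> p) w id"

definition adj_word_act :: "nat \<Rightarrow> nat list \<Rightarrow> ratfun \<Rightarrow> ratfun" where
  "adj_word_act n w = foldr (\<lambda>i f. s_gen n i \<circ> f) w id"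

definition perm_act :: "nat \<Rightarrow> nat \<Rightarrow> (nat \<Rightarrow> nat) \<Rightarrow> ratfun \<Rightarrow> ratfun" where
  "perm_act m n p = adj_word_act n (SOME w. set w \<subseteq> {1..<m} \<and> adj_word_perm w = p)"

definition t_act :: "nat \<Rightarrow> nat \<Rightarrow> nat \<Rightarrow> nat \<Rightarrow> ratfun \<Rightarrow> ratfun" where
  "t_act m n a b = perm_act m n (Transposition.transpose a b)"

text \<open>
  Sequences \<open>(\<alpha>\<^sub>1, \<dots>, \<alpha>\<^sub>m)\<close> are functions on the naturals of which only the values on \<open>{1..m}\<close> matter;
  matrix indices start at 0.
\<close>

definition alternant_mat :: "nat \<Rightarrow> nat \<Rightarrow> (nat \<Rightarrow> nat) \<Rightarrow> int \<Rightarrow> ratfun mat" where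
  "alternant_mat m n \<alpha> r = mat m m (\<lambda>(i, j).
     t_act m n (j + 1) m (\<Prod>k = 1..\<alpha> (i + 1). loop_var n m (r + int m - int k)))"

definition loop_alternant :: "nat \<Rightarrow> nat \<Rightarrow> (nat \<Rightarrow> nat) \<Rightarrow> int \<Rightarrow> ratfun" where
  "loop_alternant m n \<alpha> r = det (alternant_mat m n \<alpha> r)"

definition staircase :: "nat \<Rightarrow> nat \<Rightarrow> nat" where
  "staircase m i = m - i"

end

theory Submission
  imports Defs
begin

text \<open>
  Put \<open>z\<^sub>i(N) = x\<^sub>i\<^bsup>(r+m-N)\<^esup>\<close> and let \<open>L\<^sub>i\<close> act on sequences by
  \<open>(L\<^sub>i f)(N) = f(N) - z\<^sub>i(N) f(N-1)\<close>.  The product \<open>L\<^sub>i L\<^sub>i\<^sub>+\<^sub>1\<close> involves only the sums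
  \<open>x\<^sub>i\<^bsup>(j)\<^esup> + x\<^sub>i\<^sub>+\<^sub>1\<^bsup>(j)\<^esup>\<close> and the products \<open>x\<^sub>i\<^bsup>(j)\<^esup> x\<^sub>i\<^sub>+\<^sub>1\<^bsup>(j+1)\<^esup>\<close>, which \<open>s\<^sub>i\<close> preserves, so
  \<open>L = L\<^sub>1 \<dots> L\<^sub>m\<close> is invariant under the birational action, whatever words are chosen for the
  transpositions.  Hence every column of the alternants, as a function of the exponent, solves the
  recurrence \<open>(L f)(N) = 0\<close> for \<open>N \<ge> m\<close>.  So do the sequences \<open>L\<^sub>m\<^sup>-\<^sup>1 \<dots> L\<^sub>j\<^sub>+\<^sub>1\<^sup>-\<^sup>1\<close> applied to a unit
  sequence, whose initial values are unitriangular; comparing the two families of solutions shows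
  that \<open>a\<^bsub>\<lambda>+\<delta>\<^esub>\<close> is \<open>a\<^bsub>\<delta>\<^esub>\<close> times a determinant of Jacobi-Trudi type.  That determinant obeys the
  branching rule of semistandard tableaux (remove the entries equal to \<open>m\<close>).  Finally \<open>a\<^bsub>\<delta>\<^esub> \<noteq> 0\<close>,
  because along multiples of \<open>n\<close> the columns are powers of the pairwise distinct row products
  \<open>\<Prod>\<^sub>j x\<^sub>i\<^bsup>(j)\<^esup>\<close>, which the action permutes.
\<close>

section \<open>Polynomials and their fractions\<close>

lemma poly_mapping_additive_induct [case_names zero single add]:
  fixes p :: "'a \<Rightarrow>\<^sub>0 'b::comm_monoid_add"
  assumes zero: "P 0"
    and single: "\<And>k c. P (Poly_Mapping.single k c)"
    and add: "\<And>p q. P p \<Longrightarrow> P q \<Longrightarrow> P (p + q)"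
  shows "P p"
proof (induction p rule: Poly_Mapping.update_induct)
  case const
  show ?case by (rule zero)
next
  case (update f a b)
  have "Poly_Mapping.update a b f = f + Poly_Mapping.single a b"
    using update(1)
    by (intro poly_mapping_eqI) (auto simp: Poly_Mapping.lookup_update lookup_add lookup_single when_def in_keys_iff)
  then show ?case using add[OF update(3) single] by simp
qed

lemma mpoly_induct [case_names const var add mult]:
  fixes p :: "('v \<Rightarrow>\<^sub>0 nat) \<Rightarrow>\<^sub>0 'b::comm_semiring_1"
  assumes const: "\<And>c. P (Poly_Mapping.single 0 c)"
    and var: "\<And>v. P (Poly_Mapping.single (Poly_Mapping.single v 1) 1)"
    and add: "\<And>p q. P p \<Longrightarrow> P q \<Longrightarrow> P (p + q)"
    and mult: "\<And>p q. P p \<Longrightarrow> P q \<Longrightarrow> P (p * q)"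
  shows "P p"
proof (induction p rule: poly_mapping_additive_induct)
  case zero
  show ?case using const[of 0] by simp
next
  case (single k c)
  have one: "P (Poly_Mapping.single 0 1)" by (rule const)
  have pow: "P (Poly_Mapping.single (Poly_Mapping.single v e) 1)" for v e
  proof (induction e)
    case 0
    show ?case using one by simp
  next
    case (Suc e)
    show ?case using mult[OF Suc var[of v]] by (simp add: mult_single flip: single_add)
  qed
  have "P (Poly_Mapping.single k 1)"
  proof (induction k rule: poly_mapping_additive_induct)
    case (add k l)
    then show ?case using mult[of "Poly_Mapping.single k 1" "Poly_Mapping.single l 1"]
      by (simp add: mult_single)
  qed (use one pow in auto)
  from mult[OF const[of c] this] show ?case by (simp add: mult_single)
qed (rule add)

section \<open>Evaluation of polynomials\<close>

definition monomial_eval :: "('v \<Rightarrow> 'a) \<Rightarrow> ('v \<Rightarrow>\<^sub>0 nat) \<Rightarrow> 'a::comm_semiring_1" where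
  "monomial_eval a k = (\<Prod>v\<in>Poly_Mapping.keys k. a v ^ Poly_Mapping.lookup k v)"

lemma monomial_eval_superset:
  assumes "finite S" "Poly_Mapping.keys k \<subseteq> S"
  shows "monomial_eval a k = (\<Prod>v\<in>S. a v ^ Poly_Mapping.lookup k v)"
  unfolding monomial_eval_def using assms
  by (intro prod.mono_neutral_left) (auto simp: in_keys_iff)

lemma monomial_eval_add: "monomial_eval a (k + l) = monomial_eval a k * monomial_eval a l"
proof -
  let ?S = "Poly_Mapping.keys k \<union> Poly_Mapping.keys l"
  have "Poly_Mapping.keys (k + l) \<subseteq> ?S" by (rule Poly_Mapping.keys_add)
  then have "monomial_eval a (k + l) = (\<Prod>v\<in>?S. a v ^ Poly_Mapping.lookup (k + l) v)"
    by (intro monomial_eval_superset) auto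
  also have "\<dots> = monomial_eval a k * monomial_eval a l"
    by (simp add: lookup_add power_add prod.distrib monomial_eval_superset[of ?S])
  finally show ?thesis .
qed

text \<open>Used with \<open>rat_const\<close>, to substitute rational functions for the
  indeterminates, and with \<open>id\<close>, to evaluate at rational numbers and so certify that
  elements of the field are nonzero or distinct.\<close>

definition poly_eval :: "('c \<Rightarrow> 'a) \<Rightarrow> ('v \<Rightarrow> 'a) \<Rightarrow> (('v \<Rightarrow>\<^sub>0 nat) \<Rightarrow>\<^sub>0 'c::comm_ring_1) \<Rightarrow> 'a::comm_ring_1"
  where "poly_eval h a p = (\<Sum>k\<in>Poly_Mapping.keys p. h (Poly_Mapping.lookup p k) * monomial_eval a k)"

context
  fixes h :: "'c::comm_ring_1 \<Rightarrow> 'a::comm_ring_1"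
  assumes h: "comm_ring_hom h"
begin

interpretation h: comm_ring_hom h by (rule h)

lemma poly_eval_single: "poly_eval h a (Poly_Mapping.single k c) = h c * monomial_eval a k"
  by (cases "c = 0") (simp_all add: poly_eval_def)

lemma poly_eval_const: "poly_eval h a (Poly_Mapping.single 0 c) = h c"
  by (simp add: poly_eval_single monomial_eval_def)

lemma poly_eval_var: "poly_eval h a (Poly_Mapping.single (Poly_Mapping.single v 1) 1) = a v"
  by (simp add: poly_eval_single monomial_eval_def)

lemma poly_eval_add: "poly_eval h a (p + q) = poly_eval h a p + poly_eval h a q"
  unfolding poly_eval_def
  by (rule setsum_keys_plus_distrib) (simp_all add: h.hom_add algebra_simps)

lemma poly_eval_mult: "poly_eval h a (p * q) = poly_eval h a p * poly_eval h a q"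
proof (induction p rule: poly_mapping_additive_induct)
  case zero
  show ?case by (simp add: poly_eval_def)
next
  case (single k c)
  show ?case
  proof (induction q rule: poly_mapping_additive_induct)
    case zero
    show ?case by (simp add: poly_eval_def)
  next
    case (single l d)
    show ?case by (simp add: poly_eval_single mult_single monomial_eval_add h.hom_mult mult_ac)
  next
    case (add p q)
    then show ?case by (simp add: distrib_left poly_eval_add)
  qed
next
  case (add p q)
  then show ?case by (simp add: distrib_right poly_eval_add)
qed

lemma comm_ring_hom_poly_eval: "comm_ring_hom (poly_eval h a)"
proof
  show "poly_eval h a 1 = 1" using poly_eval_const[of a 1] by simp
  show "poly_eval h a 0 = 0" by (simp add: poly_eval_def)
qed (rule poly_eval_add poly_eval_mult)+

end

section \<open>Extending homomorphisms to the field of fractions\<close>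

lemma comm_ring_hom_to_fract: "comm_ring_hom to_fract"
  by unfold_locales auto

lemma comm_ring_hom_rat_const: "comm_ring_hom rat_const"
  by unfold_locales (auto simp: rat_const_def mult_single single_add simp flip: to_fract_mult)

lemma comm_ring_hom_comp: "comm_ring_hom f \<Longrightarrow> comm_ring_hom g \<Longrightarrow> comm_ring_hom (f \<circ> g)"
proof -
  assume "comm_ring_hom f" "comm_ring_hom g"
  then interpret f: comm_ring_hom f + g: comm_ring_hom g .
  show ?thesis by unfold_locales (auto simp: f.hom_add g.hom_add f.hom_mult g.hom_mult)
qed

lemma field_hom_divide:
  fixes f :: "'a::field \<Rightarrow> 'b::field"
  assumes "comm_ring_hom f"
  shows "f (a / b) = f a / f b"
proof -
  interpret comm_ring_hom f by fact
  interpret field_hom f ..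
  show ?thesis by (rule hom_div)
qed

lemma fract_eq_divide: obtains a b where "b \<noteq> 0" "q = to_fract a / to_fract b"
  using Fract_cases[of q] by (metis Fract_conv_to_fract)

lemma extend_hom_to_fract:
  fixes \<phi> :: "'p::idom \<Rightarrow> 'f::field"
  assumes hom: "comm_ring_hom \<phi>" and inj: "\<And>p. \<phi> p = 0 \<Longrightarrow> p = 0"
  shows "\<exists>f. comm_ring_hom f \<and> (\<forall>p. f (to_fract p) = \<phi> p)"
proof -
  interpret \<phi>: comm_ring_hom \<phi> by fact
  \<comment> \<open>Cross-multiplication and injectivity of \<phi> make the quotient independent of
    the chosen numerator and denominator.\<close>
  define f where "f q = (THE y. \<exists>a b. b \<noteq> 0 \<and> q = to_fract a / to_fract b \<and> y = \<phi> a / \<phi> b)" for q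
  have f: "f (to_fract a / to_fract b) = \<phi> a / \<phi> b" if b: "b \<noteq> 0" for a b
    unfolding f_def
  proof (rule the_equality)
    show "\<exists>c d. d \<noteq> 0 \<and> to_fract a / to_fract b = to_fract c / to_fract d \<and> \<phi> a / \<phi> b = \<phi> c / \<phi> d"
      using b by blast
  next
    fix y
    assume "\<exists>c d. d \<noteq> 0 \<and> to_fract a / to_fract b = to_fract c / to_fract d \<and> y = \<phi> c / \<phi> d"
    then obtain c d where d: "d \<noteq> 0" "to_fract a / to_fract b = to_fract c / to_fract d"
      and y: "y = \<phi> c / \<phi> d" by blast
    then have "to_fract (a * d) = to_fract (c * b)" using b by (simp add: field_simps)
    then have "\<phi> (a * d) = \<phi> (c * b)" by (simp only: to_fract_eq_iff)
    moreover have "\<phi> b \<noteq> 0" "\<phi> d \<noteq> 0" using inj b d by auto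
    ultimately show "y = \<phi> a / \<phi> b" by (simp add: y \<phi>.hom_mult field_simps)
  qed
  have f_to: "f (to_fract p) = \<phi> p" for p using f[of 1 p] by simp
  have "comm_ring_hom f"
  proof
    show "f 0 = 0" "f 1 = 1" using f_to[of 0] f_to[of 1] by auto
  next
    fix x y :: "'p fract"
    obtain a b where ab: "b \<noteq> 0" "x = to_fract a / to_fract b" by (rule fract_eq_divide)
    obtain c d where cd: "d \<noteq> 0" "y = to_fract c / to_fract d" by (rule fract_eq_divide)
    have fxy: "f x = \<phi> a / \<phi> b" "f y = \<phi> c / \<phi> d" using ab cd f by simp_all
    have nz: "\<phi> b \<noteq> 0" "\<phi> d \<noteq> 0" "b * d \<noteq> 0" using inj ab cd by auto
    have "x + y = to_fract (a * d + c * b) / to_fract (b * d)"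
      using ab cd by (simp add: field_simps)
    then have "f (x + y) = \<phi> (a * d + c * b) / \<phi> (b * d)" by (simp only: f[OF nz(3)])
    then show "f (x + y) = f x + f y"
      unfolding fxy using nz by (simp add: \<phi>.hom_add \<phi>.hom_mult field_simps)
    have "x * y = to_fract (a * c) / to_fract (b * d)"
      using ab cd by (simp add: field_simps)
    then have "f (x * y) = \<phi> (a * c) / \<phi> (b * d)" by (simp only: f[OF nz(3)])
    then show "f (x * y) = f x * f y"
      unfolding fxy using nz by (simp add: \<phi>.hom_mult field_simps)
  qed
  with f_to show ?thesis by blast
qed

text \<open>The graph of the partial extension of \<open>\<phi>\<close> to the fractions whose denominator it does not kill.\<close>

definition fract_rel :: "('p::idom \<Rightarrow> 'f::field) \<Rightarrow> 'p fract \<Rightarrow> 'f \<Rightarrow> bool" where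
  "fract_rel \<phi> q y \<longleftrightarrow> (\<exists>a b. \<phi> b \<noteq> 0 \<and> q = to_fract a / to_fract b \<and> y = \<phi> a / \<phi> b)"

context
  fixes \<phi> :: "'p::idom \<Rightarrow> 'f::field"
  assumes \<phi>: "comm_ring_hom \<phi>"
begin

interpretation \<phi>: comm_ring_hom \<phi> by (rule \<phi>)

lemma fract_rel_to_fract: "fract_rel \<phi> (to_fract p) (\<phi> p)"
  unfolding fract_rel_def by (intro exI[of _ p] exI[of _ 1]) simp

lemma
  assumes "fract_rel \<phi> q y" "fract_rel \<phi> q' y'"
  shows fract_rel_add: "fract_rel \<phi> (q + q') (y + y')"
    and fract_rel_mult: "fract_rel \<phi> (q * q') (y * y')"
    and fract_rel_divide: "y' \<noteq> 0 \<Longrightarrow> fract_rel \<phi> (q / q') (y / y')"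
proof -
  obtain a b c d where *: "\<phi> b \<noteq> 0" "q = to_fract a / to_fract b" "y = \<phi> a / \<phi> b"
    "\<phi> d \<noteq> 0" "q' = to_fract c / to_fract d" "y' = \<phi> c / \<phi> d"
    using assms unfolding fract_rel_def by blast
  then have nz: "b \<noteq> 0" "d \<noteq> 0" by auto
  show "fract_rel \<phi> (q + q') (y + y')"
    unfolding fract_rel_def using * nz
    by (intro exI[of _ "a * d + c * b"] exI[of _ "b * d"])
      (simp add: \<phi>.hom_add \<phi>.hom_mult field_simps)
  show "fract_rel \<phi> (q * q') (y * y')"
    unfolding fract_rel_def using * nz
    by (intro exI[of _ "a * c"] exI[of _ "b * d"]) (simp add: \<phi>.hom_mult field_simps)
  \<comment> \<open>As \<open>y'\<close> is the image of \<open>c\<close> divided by that of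
    \<open>d\<close>, its being nonzero lets \<open>b * c\<close> serve as a denominator.\<close>
  assume "y' \<noteq> 0"
  then show "fract_rel \<phi> (q / q') (y / y')"
    unfolding fract_rel_def using *
    by (intro exI[of _ "a * d"] exI[of _ "b * c"]) (auto simp: \<phi>.hom_mult)
qed

text \<open>A denominator not killed by \<phi> is nonzero, so any numerator representing 0 is 0.
  This fact yields the trivial kernel in \<open>ratfun_hom_exists\<close>.\<close>

lemma fract_rel_zeroD: "fract_rel \<phi> 0 y \<Longrightarrow> y = 0"
  unfolding fract_rel_def by auto

end

definition var_fract :: "nat \<Rightarrow> ratfun" where
  "var_fract v = to_fract (Poly_Mapping.single (Poly_Mapping.single v 1) 1)"

lemma indet_eq_var_fract: "indet i c = var_fract (prod_encode (i, c))"
  by (simp add: indet_def var_fract_def)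

text \<open>An endomorphism of the polynomial ring into its field of fractions that is an involution on
  the indeterminates has trivial kernel, so it extends to the field.\<close>

lemma ratfun_hom_exists:
  fixes a :: "nat \<Rightarrow> ratfun"
  assumes "\<And>v. fract_rel (poly_eval rat_const a) (a v) (var_fract v)"
  shows "\<exists>f. rat_alg_hom f \<and> (\<forall>v. f (var_fract v) = a v)"
proof -
  let ?\<phi> = "poly_eval rat_const a"
  have hom: "comm_ring_hom ?\<phi>"
    by (intro comm_ring_hom_poly_eval comm_ring_hom_rat_const)
  then interpret \<phi>: comm_ring_hom ?\<phi> .
  \<comment> \<open>Substituting twice, the second time through \<open>fract_rel\<close>, returns
    \<open>p\<close>. For the indeterminates this is the assumption, and it passes to sums and
    products.\<close>
  have rel: "fract_rel ?\<phi> (?\<phi> p) (to_fract p)" for p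
  proof (induction p rule: mpoly_induct)
    case (const c)
    show ?case using fract_rel_to_fract[OF hom, of "Poly_Mapping.single 0 c"]
      by (simp add: poly_eval_const[OF comm_ring_hom_rat_const] flip: rat_const_def)
  next
    case (var v)
    show ?case using assms[of v]
      by (simp only: poly_eval_var[OF comm_ring_hom_rat_const] flip: var_fract_def)
  next
    case (add p q)
    show ?case using fract_rel_add[OF hom add] by (simp add: \<phi>.hom_add)
  next
    case (mult p q)
    show ?case using fract_rel_mult[OF hom mult] by (simp add: \<phi>.hom_mult)
  qed
  have "p = 0" if "?\<phi> p = 0" for p
    using fract_rel_zeroD[OF hom, of "to_fract p"] rel[of p] that by simp
  then obtain f where f: "comm_ring_hom f" "\<And>p. f (to_fract p) = ?\<phi> p"
    using extend_hom_to_fract[OF hom] by blast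
  then have "f (rat_const c) = rat_const c" for c
    unfolding rat_const_def[of c] by (simp add: poly_eval_const[OF comm_ring_hom_rat_const] rat_const_def)
  moreover have "f (var_fract v) = a v" for v
    unfolding var_fract_def f(2) by (rule poly_eval_var[OF comm_ring_hom_rat_const])
  ultimately show ?thesis using f(1) unfolding rat_alg_hom_def by blast
qed

lemma ratfun_hom_eqI:
  assumes f: "rat_alg_hom f" and g: "rat_alg_hom g"
    and vars: "\<And>v. f (var_fract v) = g (var_fract v)"
  shows "f = g"
proof
  interpret f: comm_ring_hom f using f by (simp add: rat_alg_hom_def)
  interpret g: comm_ring_hom g using g by (simp add: rat_alg_hom_def)
  have eq: "f (to_fract p) = g (to_fract p)" for p
  proof (induction p rule: mpoly_induct)
    case (const c)
    show ?case using f g by (simp add: rat_alg_hom_def flip: rat_const_def)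
  next
    case (var v)
    show ?case using vars[of v] by (simp only: var_fract_def)
  qed (simp_all add: f.hom_add g.hom_add f.hom_mult g.hom_mult)
  fix q :: ratfun
  obtain a b :: "(nat \<Rightarrow>\<^sub>0 nat) \<Rightarrow>\<^sub>0 rat" where "q = to_fract a / to_fract b" by (rule fract_eq_divide)
  then show "f q = g q"
    by (simp add: field_hom_divide[OF f.comm_ring_hom_axioms]
        field_hom_divide[OF g.comm_ring_hom_axioms] eq)
qed

section \<open>The birational action\<close>

lemma prod_periodic_shift:
  fixes g :: "int \<Rightarrow> 'a::comm_monoid_mult"
  assumes g: "\<And>j. g (j + int n) = g j"
  shows "(\<Prod>k<n. g (c + int k)) = (\<Prod>k<n. g (int k))"
proof -
  have step: "(\<Prod>k<n. g (c + 1 + int k)) = (\<Prod>k<n. g (c + int k))" for c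
  proof (cases n)
    case (Suc l)
    have "g (c + 1 + int l) = g c" using g[of c] by (simp add: Suc add_ac)
    moreover have "(\<Prod>k<n. g (c + int k)) = g c * (\<Prod>k<l. g (c + 1 + int k))"
      unfolding Suc by (subst prod.lessThan_Suc_shift) (simp add: add_ac)
    ultimately show ?thesis by (simp add: Suc mult.commute)
  qed simp
  show ?thesis
  proof (induction c rule: int_induct[where k = 0])
    case (step1 i)
    then show ?case using step[of i] by simp
  next
    case (step2 i)
    then show ?case using step[of "i - 1"] by simp
  qed simp
qed

lemma prod_periodic_rev:
  fixes g :: "int \<Rightarrow> 'a::comm_monoid_mult"
  assumes g: "\<And>j. g (j + int n) = g j"
  shows "(\<Prod>k<n. g (c - int k)) = (\<Prod>k<n. g (int k))"
proof -
  have "(\<Prod>k<n. g (c - int k)) = (\<Prod>k<n. g (c - int (n - Suc k)))"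
    by (rule prod.nat_diff_reindex[symmetric])
  also have "\<dots> = (\<Prod>k<n. g ((c - int n + 1) + int k))"
    by (rule prod.cong) (auto simp: of_nat_diff algebra_simps)
  also have "\<dots> = (\<Prod>k<n. g (int k))" by (rule prod_periodic_shift) (rule g)
  finally show ?thesis .
qed

lemma kappa_hom: "comm_ring_hom f \<Longrightarrow> f (kappa n j x y) = kappa n j (\<lambda>c. f (x c)) (\<lambda>c. f (y c))"
proof -
  assume "comm_ring_hom f"
  then interpret comm_ring_hom f .
  show ?thesis unfolding kappa_def by (simp add: hom_sum hom_mult hom_prod)
qed

lemma kappa_periodic:
  assumes "\<And>j. x (j + int n) = x j" "\<And>j. y (j + int n) = y j"
  shows "kappa n (j + int n) x y = kappa n j x y"
proof -
  have "x (j + int n - int k) = x (j - int k)" "y (j + int n - int k) = y (j - int k)" for k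
    using assms[of "j - int k"] by (simp_all add: algebra_simps)
  then show ?thesis unfolding kappa_def by simp
qed

text \<open>Both sides telescope: the summand with \<open>s\<close> factors \<open>x\<close> on the left is the one with \<open>s - 1\<close>
  factors on the right.\<close>

lemma kappa_step:
  fixes x y :: "int \<Rightarrow> 'a::comm_ring_1"
  assumes n: "n \<ge> 1" and x: "\<And>j. x (j + int n) = x j" and y: "\<And>j. y (j + int n) = y j"
  shows "y (j + 1) * kappa n (j + 1) x y = x j * kappa n j x y
    + (\<Prod>k<n. y (int k)) - (\<Prod>k<n. x (int k))"
proof -
  \<comment> \<open>\<open>t s\<close> is a product over the \<open>n\<close> colours
    \<open>j, j - 1, ..., j - n + 1\<close> whose first \<open>s\<close> factors come from
    \<open>x\<close> and the others from \<open>y\<close>.\<close>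
  define t where "t s = (\<Prod>k<s. x (j - int k)) * (\<Prod>k=s..<n. y (j - int k))" for s
  have sets: "{0..n - 1} = {..<n}" using n by auto
  have "y (j + 1) * ((\<Prod>k = 1..s. x (j + 1 - int k)) * (\<Prod>k = s + 1..n - 1. y (j + 1 - int k))) = t s"
    if s: "s < n" for s
  proof -
    have "(\<Prod>k = 1..s. x (j + 1 - int k)) = (\<Prod>k<s. x (j - int k))"
      by (rule prod.reindex_bij_witness[of _ Suc "\<lambda>k. k - 1"]) (auto simp: of_nat_diff algebra_simps)
    moreover have "(\<Prod>k = s + 1..n - 1. y (j + 1 - int k)) = (\<Prod>k = s..<n - 1. y (j - int k))"
      by (rule prod.reindex_bij_witness[of _ Suc "\<lambda>k. k - 1"]) (auto simp: of_nat_diff algebra_simps)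
    \<comment> \<open>Modulo \<open>n\<close> the colour \<open>j + 1\<close> is
      \<open>j - (n - 1)\<close>, the one with which \<open>t s\<close> ends.\<close>
    moreover have "y (j + 1) = y (j - int (n - 1))"
      using y[of "j - int (n - 1)"] n by (simp add: of_nat_diff)
    moreover have "(\<Prod>k = s..<n. y (j - int k)) = (\<Prod>k = s..<n - 1. y (j - int k)) * y (j - int (n - 1))"
      using s n prod.atLeastLessThan_Suc[of s "n - 1" "\<lambda>k. y (j - int k)"] by simp
    ultimately show ?thesis by (simp add: t_def mult_ac)
  qed
  then have L: "y (j + 1) * kappa n (j + 1) x y = (\<Sum>s<n. t s)"
    unfolding kappa_def sets sum_distrib_left by (intro sum.cong) auto
  have "x j * ((\<Prod>k = 1..s. x (j - int k)) * (\<Prod>k = s + 1..n - 1. y (j - int k))) = t (Suc s)"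
    if s: "s < n" for s
  proof -
    have "(\<Prod>k = 1..s. x (j - int k)) = (\<Prod>k<s. x (j - int (Suc k)))"
      by (rule prod.reindex_bij_witness[of _ Suc "\<lambda>k. k - 1"]) (auto simp: of_nat_diff algebra_simps)
    then have "x j * (\<Prod>k = 1..s. x (j - int k)) = (\<Prod>k<Suc s. x (j - int k))"
      by (simp add: prod.lessThan_Suc_shift del: prod.lessThan_Suc)
    moreover have "{s + 1..n - 1} = {Suc s..<n}" using n by auto
    ultimately show ?thesis by (simp add: t_def mult.assoc[symmetric] del: prod.lessThan_Suc)
  qed
  then have R: "x j * kappa n j x y = (\<Sum>s<n. t (Suc s))"
    unfolding kappa_def sets sum_distrib_left by (intro sum.cong) auto
  have "(\<Sum>s<n. t s) - (\<Sum>s<n. t (Suc s)) = t 0 - t n"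
    using sum_lessThan_telescope'[of t n] by (simp add: sum_subtractf)
  moreover have "t 0 = (\<Prod>k<n. y (int k))"
    using prod_periodic_rev[of y n j, OF y] by (simp add: t_def atLeast0LessThan)
  moreover have "t n = (\<Prod>k<n. x (int k))"
    using prod_periodic_rev[of x n j, OF x] by (simp add: t_def)
  ultimately show ?thesis unfolding L R by (simp add: algebra_simps)
qed

text \<open>Two cyclic rows with values in a field; \<open>x'\<close> and \<open>y'\<close> below
  are what the generator makes of them. The condition \<open>prods\<close> is what gives the cyclic
  recursion for \<open>kappa\<close> a unique solution.\<close>

locale kappa_pair =
  fixes n :: nat and x y :: "int \<Rightarrow> 'a::field"
  assumes n: "n \<ge> 1" and x: "\<And>j. x (j + int n) = x j" and y: "\<And>j. y (j + int n) = y j"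
    and kappa_nz: "\<And>j. kappa n j x y \<noteq> 0"
    and prods: "(\<Prod>k<n. x (int k)) \<noteq> (\<Prod>k<n. y (int k))"
begin

abbreviation "K j \<equiv> kappa n j x y"
definition "x' j = y (j + 1) * K (j + 1) / K j"
definition "y' j = x (j - 1) * K (j - 1) / K j"

lemma K_periodic: "K (j + int n) = K j" by (rule kappa_periodic) (rule x y)+

lemma x'_periodic: "x' (j + int n) = x' j"
  using y[of "j + 1"] K_periodic[of j] K_periodic[of "j + 1"] by (simp add: x'_def add_ac)

lemma y'_periodic: "y' (j + int n) = y' j"
  using x[of "j - 1"] K_periodic[of j] K_periodic[of "j - 1"] by (simp add: y'_def algebra_simps)

text \<open>Around a full cycle the ratios of consecutive values of \<open>K\<close> cancel. With
  \<open>prod_y'\<close> this says that the generator exchanges the two row products.\<close>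

lemma prod_x': "(\<Prod>k<n. x' (int k)) = (\<Prod>k<n. y (int k))"
proof -
  have "(\<Prod>k<n. y (int k + 1)) = (\<Prod>k<n. y (int k))" "(\<Prod>k<n. K (int k + 1)) = (\<Prod>k<n. K (int k))"
    using prod_periodic_shift[of y n 1, OF y] prod_periodic_shift[of K n 1, OF K_periodic]
    by (simp_all add: add_ac)
  then show ?thesis by (simp add: x'_def prod_dividef prod.distrib kappa_nz)
qed

lemma prod_y': "(\<Prod>k<n. y' (int k)) = (\<Prod>k<n. x (int k))"
proof -
  have "(\<Prod>k<n. x (int k - 1)) = (\<Prod>k<n. x (int k))" "(\<Prod>k<n. K (int k - 1)) = (\<Prod>k<n. K (int k))"
    using prod_periodic_shift[of x n "-1", OF x] prod_periodic_shift[of K n "-1", OF K_periodic]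
    by simp_all
  then show ?thesis by (simp add: y'_def prod_dividef prod.distrib kappa_nz)
qed

text \<open>Take \<open>kappa_step\<close> at \<open>j\<close> and at \<open>j - 1\<close>: the
  differences of row products in the two identities cancel.\<close>

lemma add': "x' j + y' j = x j + y j"
proof -
  have "x' j + y' j = (y (j + 1) * K (j + 1) + x (j - 1) * K (j - 1)) / K j"
    by (simp add: x'_def y'_def add_divide_distrib)
  also have "y (j + 1) * K (j + 1) + x (j - 1) * K (j - 1) = (x j + y j) * K j"
    using kappa_step[of n x y j, OF n x y] kappa_step[of n x y "j - 1", OF n x y, simplified]
    by (simp add: distrib_right)
  finally show ?thesis using kappa_nz by simp
qed

lemma mult': "x' j * y' (j + 1) = x j * y (j + 1)"
  using kappa_nz by (simp add: x'_def y'_def)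

text \<open>Both \<open>K\<close> and its image solve the same cyclic linear recursion, whose monodromy is not 1.\<close>

lemma kappa_invariant: "kappa n j x' y' = K j"
proof -
  define D where "D j = kappa n j x' y' - K j" for j
  \<comment> \<open>\<open>K\<close> satisfies the \<open>kappa_step\<close> recursion of the pair
    \<open>x'\<close>, \<open>y'\<close> too: its inhomogeneous term is the same because the row
    products are exchanged. So the difference \<open>D\<close> solves the homogeneous
    recursion.\<close>
  have D: "y' (j + 1) * D (j + 1) = x' j * D j" for j
  proof -
    have "y' (j + 1) * K (j + 1) = x j * K j" "x' j * K j = y (j + 1) * K (j + 1)"
      using kappa_nz by (simp_all add: x'_def y'_def)
    then show ?thesis
      using kappa_step[of n x' y' j, OF n x'_periodic y'_periodic] kappa_step[of n x y j, OF n x y]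
      unfolding prod_x' prod_y' by (simp add: D_def right_diff_distrib)
  qed
  have iter: "(\<Prod>k<q. y' (j + 1 + int k)) * D (j + int q) = (\<Prod>k<q. x' (j + int k)) * D j" for q
  proof (induction q)
    case (Suc q)
    have "(\<Prod>k<Suc q. y' (j + 1 + int k)) * D (j + int (Suc q))
      = (\<Prod>k<q. y' (j + 1 + int k)) * (y' (j + int q + 1) * D (j + int q + 1))"
      by (simp add: algebra_simps)
    also have "\<dots> = x' (j + int q) * ((\<Prod>k<q. y' (j + 1 + int k)) * D (j + int q))"
      by (simp only: D) (simp only: mult_ac)
    also have "\<dots> = (\<Prod>k<Suc q. x' (j + int k)) * D j"
      by (simp only: Suc) (simp only: prod.lessThan_Suc mult_ac)
    finally show ?case .
  qed simp
  \<comment> \<open>Going once around the cycle multiplies by all of \<open>x'\<close> on one side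
    and all of \<open>y'\<close> on the other; since these two products differ, \<open>D\<close>
    must vanish.\<close>
  have "D (j + int n) = D j"
    using kappa_periodic[of x' n y' j, OF x'_periodic y'_periodic] K_periodic by (simp add: D_def)
  then have "(\<Prod>k<n. x (int k)) * D j = (\<Prod>k<n. y (int k)) * D j"
    using iter[of n] prod_periodic_shift[of y' n "j + 1", OF y'_periodic]
      prod_periodic_shift[of x' n j, OF x'_periodic] by (simp add: prod_x' prod_y')
  then show ?thesis using prods by (simp add: D_def)
qed

text \<open>Since \<open>kappa\<close> is unchanged, the ratios introduced by a second application
  of the generator cancel those of the first. This supplies the hypothesis of
  \<open>ratfun_hom_exists\<close>.\<close>

lemma involution:
  "y' (j + 1) * kappa n (j + 1) x' y' / kappa n j x' y' = x j"
  "x' (j - 1) * kappa n (j - 1) x' y' / kappa n j x' y' = y j"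
  unfolding kappa_invariant using kappa_nz by (simp_all add: x'_def y'_def)

end

section \<open>The generators on the field of rational functions\<close>

definition poly_loop_var :: "nat \<Rightarrow> nat \<Rightarrow> int \<Rightarrow> (nat \<Rightarrow>\<^sub>0 nat) \<Rightarrow>\<^sub>0 rat" where
  "poly_loop_var n i j = Poly_Mapping.single (Poly_Mapping.single (prod_encode (i, nat (j mod int n))) 1) 1"

lemma loop_var_to_fract: "loop_var n i j = to_fract (poly_loop_var n i j)"
  by (simp add: loop_var_def indet_def poly_loop_var_def)

lemma poly_eval_loop_var:
  "comm_ring_hom h \<Longrightarrow> poly_eval h a (poly_loop_var n i j) = a (prod_encode (i, nat (j mod int n)))"
  unfolding poly_loop_var_def by (rule poly_eval_var)

lemma loop_var_periodic: "loop_var n i (j + int n) = loop_var n i j"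
  by (simp add: loop_var_def)

lemma kappa_loop_var_to_fract:
  "kappa n j (loop_var n i) (loop_var n k) = to_fract (kappa n j (poly_loop_var n i) (poly_loop_var n k))"
  unfolding kappa_hom[OF comm_ring_hom_to_fract] by (simp add: loop_var_to_fract[abs_def])

lemma comm_ring_hom_id: "comm_ring_hom id" by unfold_locales auto

text \<open>Setting every indeterminate to 1 gives the value \<open>n\<close>, the number of
  summands.\<close>

lemma kappa_loop_var_nonzero:
  assumes "n \<ge> 1"
  shows "kappa n j (loop_var n i) (loop_var n k) \<noteq> 0"
proof
  let ?e = "poly_eval id (\<lambda>_. 1) :: ((nat \<Rightarrow>\<^sub>0 nat) \<Rightarrow>\<^sub>0 rat) \<Rightarrow> rat"
  have hom: "comm_ring_hom ?e" by (intro comm_ring_hom_poly_eval comm_ring_hom_id)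
  then interpret comm_ring_hom ?e .
  assume "kappa n j (loop_var n i) (loop_var n k) = 0"
  then have "kappa n j (poly_loop_var n i) (poly_loop_var n k) = 0"
    by (simp add: kappa_loop_var_to_fract)
  from arg_cong[OF this, of ?e] have "kappa n j (\<lambda>_. 1) (\<lambda>_. 1) = (0 :: rat)"
    by (simp add: kappa_hom[OF hom] poly_eval_loop_var[OF comm_ring_hom_id])
  then show False using assms by (simp add: kappa_def)
qed

definition row_prod :: "nat \<Rightarrow> nat \<Rightarrow> ratfun" where
  "row_prod n i = (\<Prod>k<n. loop_var n i (int k))"

text \<open>Set the indeterminates of row \<open>i\<close> to 2 and all others to 1: only the
  product of row \<open>i\<close> takes the value \<open>2 ^ n\<close>.\<close>

lemma row_prod_eq_iff:
  assumes "n \<ge> 1"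
  shows "row_prod n i = row_prod n k \<longleftrightarrow> i = k"
proof
  let ?a = "\<lambda>v. if fst (prod_decode v) = i then 2 else (1 :: rat)"
  let ?e = "poly_eval id ?a"
  have hom: "comm_ring_hom ?e" by (intro comm_ring_hom_poly_eval comm_ring_hom_id)
  then interpret comm_ring_hom ?e .
  interpret tf: comm_ring_hom "to_fract :: ((nat \<Rightarrow>\<^sub>0 nat) \<Rightarrow>\<^sub>0 rat) \<Rightarrow> _" by (rule comm_ring_hom_to_fract)
  have eq: "row_prod n l = to_fract (\<Prod>j<n. poly_loop_var n l (int j))" for l
    by (simp add: row_prod_def loop_var_to_fract tf.hom_prod)
  assume "row_prod n i = row_prod n k"
  then have "(\<Prod>j<n. poly_loop_var n i (int j)) = (\<Prod>j<n. poly_loop_var n k (int j))"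
    unfolding eq by (simp only: to_fract_eq_iff)
  from arg_cong[OF this, of ?e] have "2 ^ n = (if k = i then 2 else (1 :: rat)) ^ n"
    by (simp add: hom_prod poly_eval_loop_var[OF comm_ring_hom_id])
  then show "i = k" using assms one_less_power[of "2 :: rat" n] by (auto split: if_splits)
qed simp

lemma kappa_pair_loop_var: "n \<ge> 1 \<Longrightarrow> i \<noteq> k \<Longrightarrow> kappa_pair n (loop_var n i) (loop_var n k)"
  using row_prod_eq_iff[of n i k]
  by unfold_locales (auto simp: loop_var_periodic kappa_loop_var_nonzero row_prod_def)

text \<open>The definite description in \<open>s_gen\<close> denotes: existence comes from the
  involution property, uniqueness from the fact that all indeterminates have prescribed
  images.\<close>

lemma s_gen:
  assumes n: "n \<ge> 1"
  shows "rat_alg_hom (s_gen n i) \<and>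
     (\<forall>k c. (k \<noteq> i \<and> k \<noteq> i + 1) \<or> c \<ge> n \<longrightarrow> s_gen n i (indet k c) = indet k c) \<and>
     (\<forall>j. s_gen n i (loop_var n i j) =
        loop_var n (i + 1) (j + 1) * kappa n (j + 1) (loop_var n i) (loop_var n (i + 1))
          / kappa n j (loop_var n i) (loop_var n (i + 1))) \<and>
     (\<forall>j. s_gen n i (loop_var n (i + 1) j) =
        loop_var n i (j - 1) * kappa n (j - 1) (loop_var n i) (loop_var n (i + 1))
          / kappa n j (loop_var n i) (loop_var n (i + 1)))"
proof -
  interpret kappa_pair n "loop_var n i" "loop_var n (i + 1)"
    by (rule kappa_pair_loop_var[OF n]) simp
  define a where "a v = (case prod_decode v of (k, c) \<Rightarrow>
    if k = i \<and> c < n then x' (int c) else if k = i + 1 \<and> c < n then y' (int c) else indet k c)" for v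
  \<comment> \<open>The assignment \<open>a\<close> reads \<open>x'\<close> and \<open>y'\<close>
    only at representatives below \<open>n\<close>; periodicity carries its values to arbitrary
    integer colours.\<close>
  have mod_periodic: "g (j mod int n) = g j" if "\<And>j. g (j + int n) = g j" for g :: "int \<Rightarrow> ratfun" and j
  proof -
    have pos: "g (j + int q * int n) = g j" for j q
    proof (induction q)
      case (Suc q)
      then show ?case using that[of "j + int q * int n"] by (simp add: algebra_simps)
    qed simp
    show ?thesis
    proof (cases "j div int n \<ge> 0")
      case True
      then show ?thesis using pos[of "j mod int n" "nat (j div int n)"] by simp
    next
      case False
      then show ?thesis using pos[of j "nat (- (j div int n))"] by (simp add: minus_div_mult_eq_mod)
    qed
  qed
  have nat_mod: "nat (j mod int n) < n" "int (nat (j mod int n)) = j mod int n" for j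
    using n by (auto simp: nat_less_iff)
  have ax: "a (prod_encode (i, nat (j mod int n))) = x' j"
    and ay: "a (prod_encode (i + 1, nat (j mod int n))) = y' j" for j
    using mod_periodic[of x', OF x'_periodic] mod_periodic[of y', OF y'_periodic]
    by (simp_all add: a_def nat_mod del: int_nat_eq)
  let ?\<phi> = "poly_eval rat_const a"
  note crc = comm_ring_hom_rat_const
  have hom: "comm_ring_hom ?\<phi>" by (intro comm_ring_hom_poly_eval crc)
  have rx: "fract_rel ?\<phi> (loop_var n i j) (x' j)" and ry: "fract_rel ?\<phi> (loop_var n (i + 1) j) (y' j)" for j
    using fract_rel_to_fract[OF hom, of "poly_loop_var n i j"]
      fract_rel_to_fract[OF hom, of "poly_loop_var n (i + 1) j"]
    by (simp_all only: poly_eval_loop_var[OF crc] ax ay loop_var_to_fract)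
  have rk: "fract_rel ?\<phi> (K j) (kappa n j x' y')" for j
    using fract_rel_to_fract[OF hom, of "kappa n j (poly_loop_var n i) (poly_loop_var n (i + 1))"]
    by (simp only: kappa_hom[OF hom] poly_eval_loop_var[OF crc] ax ay kappa_loop_var_to_fract)
  have kx: "kappa n j x' y' \<noteq> 0" for j by (simp only: kappa_invariant kappa_nz not_False_eq_True)
  \<comment> \<open>Applying the substitution to \<open>x'\<close> itself: numerator and denominator
    are mapped separately, and \<open>involution\<close> recognises the quotient as the original
    indeterminate.\<close>
  have rx': "fract_rel ?\<phi> (x' j) (loop_var n i j)" for j
    using fract_rel_divide[OF hom fract_rel_mult[OF hom ry[of "j + 1"] rk[of "j + 1"]] rk[of j] kx]
    unfolding involution x'_def[symmetric] .
  have ry': "fract_rel ?\<phi> (y' j) (loop_var n (i + 1) j)" for j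
    using fract_rel_divide[OF hom fract_rel_mult[OF hom rx[of "j - 1"] rk[of "j - 1"]] rk[of j] kx]
    unfolding involution y'_def[symmetric] .
  have "fract_rel ?\<phi> (a v) (var_fract v)" for v
  proof -
    obtain k c where v: "v = prod_encode (k, c)" by (metis prod_encode_inverse prod_decode_inverse surj_pair)
    have lv: "indet k c = loop_var n k (int c)" if "c < n" for k using that by (simp add: loop_var_def)
    consider "k = i" "c < n" | "k = i + 1" "c < n" | "\<not> ((k = i \<or> k = i + 1) \<and> c < n)"
      by blast
    then show ?thesis
    proof cases
      case 1
      then show ?thesis using rx'[of "int c"] by (simp add: v a_def flip: indet_eq_var_fract lv)
    next
      case 2
      then show ?thesis using ry'[of "int c"] by (simp add: v a_def flip: indet_eq_var_fract lv)
    next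
      case 3
      then have av: "a v = var_fract v" by (auto simp: v a_def indet_eq_var_fract)
      then have "?\<phi> (Poly_Mapping.single (Poly_Mapping.single v 1) 1) = var_fract v"
        by (simp only: poly_eval_var[OF crc])
      then show ?thesis
        using fract_rel_to_fract[OF hom, of "Poly_Mapping.single (Poly_Mapping.single v 1) 1"] av
        by (simp only: var_fract_def[symmetric])
    qed
  qed
  from ratfun_hom_exists[OF this] obtain f
    where f: "rat_alg_hom f" "\<And>v. f (var_fract v) = a v" by blast
  have fi: "f (indet k c) = a (prod_encode (k, c))" for k c
    by (simp add: indet_eq_var_fract f)
  have ex: "rat_alg_hom f \<and>
     (\<forall>k c. (k \<noteq> i \<and> k \<noteq> i + 1) \<or> c \<ge> n \<longrightarrow> f (indet k c) = indet k c) \<and>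
     (\<forall>j. f (loop_var n i j) = x' j) \<and> (\<forall>j. f (loop_var n (i + 1) j) = y' j)"
    using f(1) fi ax ay by (auto simp: loop_var_def a_def)
  have "s_gen n i = f"
    unfolding s_gen_def
  proof (rule the_equality)
    show "rat_alg_hom f \<and>
     (\<forall>k c. (k \<noteq> i \<and> k \<noteq> i + 1) \<or> c \<ge> n \<longrightarrow> f (indet k c) = indet k c) \<and>
     (\<forall>j. f (loop_var n i j) = loop_var n (i + 1) (j + 1) * K (j + 1) / K j) \<and>
     (\<forall>j. f (loop_var n (i + 1) j) = loop_var n i (j - 1) * K (j - 1) / K j)"
      using ex unfolding x'_def y'_def .
  next
    fix g
    assume g: "rat_alg_hom g \<and>
     (\<forall>k c. (k \<noteq> i \<and> k \<noteq> i + 1) \<or> c \<ge> n \<longrightarrow> g (indet k c) = indet k c) \<and>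
     (\<forall>j. g (loop_var n i j) = loop_var n (i + 1) (j + 1) * K (j + 1) / K j) \<and>
     (\<forall>j. g (loop_var n (i + 1) j) = loop_var n i (j - 1) * K (j - 1) / K j)"
    show "g = f"
    proof (rule ratfun_hom_eqI)
      fix v
      obtain k c where v: "v = prod_encode (k, c)" by (metis prod_encode_inverse prod_decode_inverse surj_pair)
      have "g (indet k c) = f (indet k c)"
      proof (cases "(k = i \<or> k = i + 1) \<and> c < n")
        case True
        then have "indet k c = loop_var n k (int c)" by (simp add: loop_var_def)
        then show ?thesis using True g ex unfolding x'_def y'_def by metis
      next
        case False
        then show ?thesis using g ex by (metis linorder_not_le)
      qed
      then show "g (var_fract v) = f (var_fract v)" by (simp add: v indet_eq_var_fract)
    qed (use g f in auto)
  qed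
  then show ?thesis using ex unfolding x'_def y'_def by simp
qed

text \<open>These properties of the generators are the only ones that the recurrence argument uses.
  The colours \<open>j\<close> and \<open>j + 1\<close> in the product match the adjacent indices in
  \<open>rec_ops_swap\<close>.\<close>

lemma
  assumes n: "n \<ge> 1"
  shows comm_ring_hom_s_gen: "comm_ring_hom (s_gen n i)"
    and s_gen_other: "k \<noteq> i \<Longrightarrow> k \<noteq> i + 1 \<Longrightarrow> s_gen n i (loop_var n k j) = loop_var n k j"
    and s_gen_add: "s_gen n i (loop_var n i j) + s_gen n i (loop_var n (i + 1) j)
      = loop_var n i j + loop_var n (i + 1) j"
    and s_gen_mult: "s_gen n i (loop_var n i j) * s_gen n i (loop_var n (i + 1) (j + 1))
      = loop_var n i j * loop_var n (i + 1) (j + 1)"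
    and s_gen_row_prod: "s_gen n i (row_prod n k) = row_prod n (Transposition.transpose i (i + 1) k)"
proof -
  interpret kappa_pair n "loop_var n i" "loop_var n (i + 1)"
    by (rule kappa_pair_loop_var[OF n]) simp
  note s = s_gen[OF n, of i, folded x'_def y'_def]
  show hom: "comm_ring_hom (s_gen n i)" using s by (simp add: rat_alg_hom_def)
  interpret comm_ring_hom "s_gen n i" by (rule hom)
  show other: "s_gen n i (loop_var n k j) = loop_var n k j" if "k \<noteq> i" "k \<noteq> i + 1" for k j
    using s that by (simp add: loop_var_def)
  show "s_gen n i (loop_var n i j) + s_gen n i (loop_var n (i + 1) j)
      = loop_var n i j + loop_var n (i + 1) j"
    using s add' by auto
  show "s_gen n i (loop_var n i j) * s_gen n i (loop_var n (i + 1) (j + 1))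
      = loop_var n i j * loop_var n (i + 1) (j + 1)"
    using s mult' by auto
  show "s_gen n i (row_prod n k) = row_prod n (Transposition.transpose i (i + 1) k)"
    using s prod_x' prod_y' other[of k]
    by (cases "k = i"; cases "k = i + 1") (simp_all add: row_prod_def hom_prod)
qed

section \<open>Linear recurrences\<close>

text \<open>The value at index 0 amounts to extending \<open>f\<close> by 0 to negative indices,
  which makes the operator invertible.\<close>

definition rec_op :: "(nat \<Rightarrow> 'a) \<Rightarrow> (nat \<Rightarrow> 'a) \<Rightarrow> nat \<Rightarrow> 'a::comm_ring_1" where
  "rec_op z f N = (case N of 0 \<Rightarrow> f 0 | Suc M \<Rightarrow> f (Suc M) - z (Suc M) * f M)"

lemma rec_op_simps [simp]:
  "rec_op z f 0 = f 0"
  "rec_op z f (Suc N) = f (Suc N) - z (Suc N) * f N"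
  by (simp_all add: rec_op_def)

text \<open>The operator of row \<open>v\<close> acts first, so this is the composite
  \<open>rec_op (zs 1)\<close>, ..., \<open>rec_op (zs v)\<close> read from the outside in.\<close>

primrec rec_ops :: "(nat \<Rightarrow> nat \<Rightarrow> 'a) \<Rightarrow> nat \<Rightarrow> (nat \<Rightarrow> 'a) \<Rightarrow> nat \<Rightarrow> 'a::comm_ring_1" where
  "rec_ops zs 0 f = f"
| "rec_ops zs (Suc v) f = rec_ops zs v (rec_op (zs (Suc v)) f)"

lemma rec_op_sum:
  "rec_op z (\<lambda>N. \<Sum>j\<in>J. c j * f j N) = (\<lambda>N. \<Sum>j\<in>J. c j * rec_op z (f j) N)"
proof
  show "rec_op z (\<lambda>N. \<Sum>j\<in>J. c j * f j N) N = (\<Sum>j\<in>J. c j * rec_op z (f j) N)" for N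
    by (cases N) (simp_all add: sum_distrib_left right_diff_distrib sum_subtractf mult_ac)
qed

lemma rec_ops_sum:
  "rec_ops zs v (\<lambda>N. \<Sum>j\<in>J. c j * f j N) = (\<lambda>N. \<Sum>j\<in>J. c j * rec_ops zs v (f j) N)"
  by (induction v arbitrary: f) (simp_all add: rec_op_sum)

lemma rec_ops_diff: "rec_ops zs v (\<lambda>N. f N - g N) N = rec_ops zs v f N - rec_ops zs v g N"
proof (induction v arbitrary: f g)
  case (Suc v)
  have "rec_op (zs (Suc v)) (\<lambda>N. f N - g N) = (\<lambda>N. rec_op (zs (Suc v)) f N - rec_op (zs (Suc v)) g N)"
    by (auto simp: fun_eq_iff rec_op_def algebra_simps split: nat.split)
  then show ?case by (simp add: Suc)
qed simp

text \<open>Each factor is the identity minus a weighted shift to the right, so it cannot affect the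
  first nonzero value.\<close>

lemma rec_ops_leading:
  assumes "\<And>K. K < N \<Longrightarrow> f K = 0"
  shows "K < N \<Longrightarrow> rec_ops zs v f K = 0" and "rec_ops zs v f N = f N"
proof -
  have "(\<forall>K<N. rec_ops zs v f K = 0) \<and> rec_ops zs v f N = f N"
    using assms
  proof (induction v arbitrary: f)
    case (Suc v)
    have "rec_op (zs (Suc v)) f K = 0" if "K < N" for K
      using that Suc.prems by (cases K) auto
    moreover have "rec_op (zs (Suc v)) f N = f N"
      using Suc.prems by (cases N) auto
    ultimately show ?case using Suc.IH by auto
  qed simp
  then show "K < N \<Longrightarrow> rec_ops zs v f K = 0" "rec_ops zs v f N = f N" by auto
qed

text \<open>Each factor extends the support by at most one index.\<close>

lemma rec_ops_support:
  assumes "\<And>K. K > M \<Longrightarrow> f K = 0" "K > M + v"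
  shows "rec_ops zs v f K = 0"
  using assms
proof (induction v arbitrary: f M)
  case (Suc v)
  have "rec_op (zs (Suc v)) f K = 0" if "K > Suc M" for K
    using that Suc.prems(1) by (cases K) auto
  then show ?case using Suc.IH[of "Suc M"] Suc.prems(2) by simp
qed simp

lemma rec_ops_cong: "(\<And>i. 1 \<le> i \<Longrightarrow> i \<le> v \<Longrightarrow> zs i = zs' i) \<Longrightarrow> rec_ops zs v f = rec_ops zs' v f"
  by (induction v arbitrary: f) simp_all

text \<open>In the two adjacent factors, the coefficient of \<open>f (N - 1)\<close> is minus the
  sum in \<open>add\<close>, and that of \<open>f (N - 2)\<close> is the product in
  \<open>mult\<close>.\<close>

lemma rec_ops_swap:
  assumes i: "1 \<le> i" "Suc i \<le> v"
    and other: "\<And>k. k \<noteq> i \<Longrightarrow> k \<noteq> Suc i \<Longrightarrow> zs k = zs' k"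
    and add: "\<And>N. zs i N + zs (Suc i) N = zs' i N + zs' (Suc i) N"
    and mult: "\<And>N. zs i (Suc N) * zs (Suc i) N = zs' i (Suc N) * zs' (Suc i) N"
  shows "rec_ops zs v f = rec_ops zs' v f"
  using i(2)
proof (induction v arbitrary: f rule: dec_induct)
  case base
  obtain l where l: "i = Suc l" using i(1) by (cases i) auto
  have eq: "rec_op (zs i) (rec_op (zs (Suc i)) f) = rec_op (zs' i) (rec_op (zs' (Suc i)) f)"
  proof
    fix N
    have expand: "rec_op (ws i) (rec_op (ws (Suc i)) f) (Suc (Suc M)) = f (Suc (Suc M))
      - (ws i (Suc (Suc M)) + ws (Suc i) (Suc (Suc M))) * f (Suc M)
      + (ws i (Suc (Suc M)) * ws (Suc i) (Suc M)) * f M" for ws :: "nat \<Rightarrow> nat \<Rightarrow> 'a" and M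
      by (simp add: algebra_simps)
    have expand1: "rec_op (ws i) (rec_op (ws (Suc i)) f) (Suc 0) = f (Suc 0)
      - (ws i (Suc 0) + ws (Suc i) (Suc 0)) * f 0" for ws :: "nat \<Rightarrow> nat \<Rightarrow> 'a"
      by (simp add: algebra_simps)
    show "rec_op (zs i) (rec_op (zs (Suc i)) f) N = rec_op (zs' i) (rec_op (zs' (Suc i)) f) N"
    proof (cases N)
      case (Suc M)
      then show ?thesis
        by (cases M) (simp_all only: expand expand1 add mult)
    qed simp
  qed
  have "rec_ops zs l g = rec_ops zs' l g" for g
    by (rule rec_ops_cong) (auto simp: l intro!: other)
  then show ?case using eq by (simp add: l)
next
  case (step v)
  then show ?case using other[of "Suc v"] by simp
qed

definition rec_solution :: "(nat \<Rightarrow> nat \<Rightarrow> 'a) \<Rightarrow> nat \<Rightarrow> (nat \<Rightarrow> 'a::comm_ring_1) \<Rightarrow> bool" where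
  "rec_solution zs m f \<longleftrightarrow> (\<forall>N\<ge>m. rec_ops zs m f N = 0)"

lemma rec_solution_sum:
  "(\<And>j. j \<in> J \<Longrightarrow> rec_solution zs m (f j)) \<Longrightarrow> rec_solution zs m (\<lambda>N. \<Sum>j\<in>J. c j * f j N)"
  by (auto simp: rec_solution_def rec_ops_sum intro!: sum.neutral)

lemma rec_solution_diff:
  "rec_solution zs m f \<Longrightarrow> rec_solution zs m g \<Longrightarrow> rec_solution zs m (\<lambda>N. f N - g N)"
  by (auto simp: rec_solution_def rec_ops_diff)

text \<open>The leading coefficient is 1, so every value from index \<open>m\<close> on is
  determined by the earlier ones.\<close>

lemma rec_solution_eq_0:
  assumes sol: "rec_solution zs m f" and init: "\<And>N. N < m \<Longrightarrow> f N = 0"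
  shows "f N = 0"
proof (induction N rule: less_induct)
  case (less N)
  show ?case
  proof (cases "N < m")
    case False
    then have "rec_ops zs m f N = 0" using sol by (simp add: rec_solution_def)
    then show ?thesis using rec_ops_leading(2)[of N f zs m] less by simp
  qed (rule init)
qed

text \<open>The innermost operator turns these partial products into the unit sequence at 0, and the
  remaining \<open>m - 1\<close> operators spread its support no further than index
  \<open>m - 1\<close>.\<close>

lemma rec_solution_geometric:
  assumes "m \<ge> 1"
  shows "rec_solution zs m (\<lambda>N. \<Prod>k=1..N. zs m k)"
proof -
  obtain l where m: "m = Suc l" using assms by (cases m) auto
  have "rec_op (zs m) (\<lambda>N. \<Prod>k=1..N. zs m k) = (\<lambda>N. if N = 0 then 1 else 0)"
    by (auto simp: fun_eq_iff rec_op_def split: nat.split)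
  then show ?thesis
    unfolding rec_solution_def m by (auto intro!: rec_ops_support[of 0])
qed

section \<open>Determinants formed from solutions\<close>

lemma det_unitriangular:
  fixes A :: "'a::idom mat"
  assumes "A \<in> carrier_mat n n" "\<And>i j. j < i \<Longrightarrow> i < n \<Longrightarrow> A $$ (i, j) = 0"
    "\<And>i. i < n \<Longrightarrow> A $$ (i, i) = 1"
  shows "det A = 1"
proof -
  have "upper_triangular A" using assms by (auto intro!: upper_triangularI)
  then have "det A = prod_list (diag_mat A)" using assms(1) by (rule det_upper_triangular)
  also have "\<dots> = (\<Prod>i = 0..<n. A $$ (i, i))" using assms(1) by (simp add: prod_list_diag_prod)
  finally show ?thesis using assms(3) by simp
qed

text \<open>The \<open>g j\<close> form a basis of the solutions, because their initial values are
  unitriangular. The transition matrix does not depend on the rows \<open>Ns\<close>; at the rows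
  \<open>m - 1 - i\<close> the determinant of \<open>g\<close> is 1, which identifies the
  determinant of the transition matrix.\<close>

lemma det_rec_solutions:
  fixes f g :: "nat \<Rightarrow> nat \<Rightarrow> 'a::idom"
  assumes f: "\<And>j. j < m \<Longrightarrow> rec_solution zs m (f j)"
    and g: "\<And>j. j < m \<Longrightarrow> rec_solution zs m (g j)"
    and g0: "\<And>j N. j < m \<Longrightarrow> N < m - 1 - j \<Longrightarrow> g j N = 0"
    and g1: "\<And>j. j < m \<Longrightarrow> g j (m - 1 - j) = 1"
  shows "det (mat m m (\<lambda>(i, j). f j (Ns i))) =
    det (mat m m (\<lambda>(i, j). g j (Ns i))) * det (mat m m (\<lambda>(i, j). f j (m - 1 - i)))"
proof -
  have ex: "\<exists>a. \<forall>N. u N = (\<Sum>k<m. a k * g k N)" if u: "rec_solution zs m u" for u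
  proof -
    have "\<exists>a. \<forall>N<l. u N = (\<Sum>k<l. a k * g (m - 1 - k) N)" if "l \<le> m" for l
      using that
    proof (induction l)
      case (Suc l)
      then obtain a where a: "\<And>N. N < l \<Longrightarrow> u N = (\<Sum>k<l. a k * g (m - 1 - k) N)" by auto
      \<comment> \<open>The sequence \<open>g (m - 1 - l)\<close> starts at index \<open>l\<close>
        with value 1, so its coefficient corrects the value at \<open>l\<close> without disturbing
        earlier ones.\<close>
      define b where "b = a(l := u l - (\<Sum>k<l. a k * g (m - 1 - k) l))"
      have b: "(\<Sum>k<l. b k * g (m - 1 - k) N) = (\<Sum>k<l. a k * g (m - 1 - k) N)" for N
        by (rule sum.cong) (auto simp: b_def)
      have "u N = (\<Sum>k<Suc l. b k * g (m - 1 - k) N)" if N: "N < Suc l" for N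
      proof (cases "N = l")
        case True
        have "g (m - 1 - l) l = 1" using g1[of "m - 1 - l"] Suc.prems by simp
        then show ?thesis using b[of l] by (simp add: True) (simp add: b_def)
      next
        case False
        have "g (m - 1 - l) N = 0" using g0[of "m - 1 - l" N] Suc.prems N False by simp
        then show ?thesis using b[of N] a[of N] N False by simp
      qed
      then show ?case by blast
    qed simp
    then obtain a where a: "\<And>N. N < m \<Longrightarrow> u N = (\<Sum>k<m. a k * g (m - 1 - k) N)" by blast
    define c where "c k = a (m - 1 - k)" for k
    have c: "u N = (\<Sum>k<m. c k * g k N)" if "N < m" for N
      unfolding a[OF that] c_def
      by (rule sum.reindex_bij_witness[of _ "\<lambda>k. m - 1 - k" "\<lambda>k. m - 1 - k"]) auto
    have "u N - (\<Sum>k<m. c k * g k N) = 0" for N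
      by (rule rec_solution_eq_0[where zs = zs and m = m and f = "\<lambda>N. u N - (\<Sum>k<m. c k * g k N)"])
        (use c in \<open>auto intro!: rec_solution_diff rec_solution_sum u g\<close>)
    then show ?thesis by (intro exI[of _ c]) simp
  qed
  then have "\<forall>j. \<exists>a. j < m \<longrightarrow> (\<forall>N. f j N = (\<Sum>k<m. a k * g k N))" using f by blast
  then obtain a where a: "\<And>j N. j < m \<Longrightarrow> f j N = (\<Sum>k<m. a j k * g k N)" by metis
  let ?A = "mat m m (\<lambda>(k, j). a j k)"
  have prod: "mat m m (\<lambda>(i, j). f j (Ns i)) = mat m m (\<lambda>(i, k). g k (Ns i)) * ?A" for Ns
    by (rule eq_matI) (auto simp: a scalar_prod_def atLeast0LessThan mult.commute intro!: sum.cong)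
  have "det (mat m m (\<lambda>(i, j). f j (Ns i))) = det (mat m m (\<lambda>(i, k). g k (Ns i))) * det ?A" for Ns
    unfolding prod by (rule det_mult) auto
  moreover have "det (mat m m (\<lambda>(i, k). g k (m - 1 - i))) = 1"
    by (rule det_unitriangular[of _ m]) (use g0 g1 in auto)
  ultimately show ?thesis by simp
qed

text \<open>A linear relation between the columns propagates along the recurrence; restricted to the
  multiples of \<open>n\<close> it would be a relation between the powers of the distinct \<open>p j\<close>.\<close>

lemma det_rec_solutions_nonzero:
  fixes f :: "nat \<Rightarrow> nat \<Rightarrow> 'a::idom"
  assumes f: "\<And>j. j < m \<Longrightarrow> rec_solution zs m (f j)"
    and p: "\<And>j q. j < m \<Longrightarrow> f j (q * n) = p j ^ q"
    and inj: "inj_on p {..<m}"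
  shows "det (mat m m (\<lambda>(i, j). f j (m - 1 - i))) \<noteq> 0"
proof
  let ?M = "mat m m (\<lambda>(i, j). f j (m - 1 - i))"
  assume "det ?M = 0"
  then obtain w where w: "w \<in> carrier_vec m" "w \<noteq> 0\<^sub>v m" "?M *\<^sub>v w = 0\<^sub>v m"
    using det_0_iff_vec_prod_zero[of ?M m] by auto
  define u where "u N = (\<Sum>j<m. w $ j * f j N)" for N
  have "u N = 0" if "N < m" for N
  proof -
    have "(?M *\<^sub>v w) $ (m - 1 - N) = u (m - 1 - (m - 1 - N))"
      using that w(1) by (auto simp: u_def scalar_prod_def atLeast0LessThan mult.commute intro!: sum.cong)
    then show ?thesis unfolding w(3) using that by simp
  qed
  moreover have "rec_solution zs m u"
    unfolding u_def[abs_def] by (intro rec_solution_sum f) auto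
  ultimately have u0: "u N = 0" for N using rec_solution_eq_0 by blast
  have pow: "(\<Sum>j<m. w $ j * p j ^ q) = 0" for q
    using u0[of "q * n"] by (simp add: u_def p)
  \<comment> \<open>By linearity the relation between powers becomes one between the values of any
    polynomial.\<close>
  have poly: "(\<Sum>j<m. w $ j * poly Q (p j)) = 0" for Q
  proof -
    have "(\<Sum>j<m. w $ j * poly Q (p j)) = (\<Sum>j<m. \<Sum>q\<le>degree Q. coeff Q q * (w $ j * p j ^ q))"
      by (simp add: poly_altdef sum_distrib_left mult_ac)
    also have "\<dots> = (\<Sum>q\<le>degree Q. coeff Q q * (\<Sum>j<m. w $ j * p j ^ q))"
      by (subst sum.swap) (simp add: sum_distrib_left)
    finally show ?thesis by (simp add: pow)
  qed
  have "w $ l = 0" if l: "l < m" for l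
  proof -
    \<comment> \<open>Lagrange interpolation: \<open>Q\<close> vanishes at every node except
      \<open>p l\<close>, which isolates the coefficient \<open>w $ l\<close>.\<close>
    define Q where "Q = (\<Prod>k\<in>{..<m} - {l}. [:- p k, 1:])"
    have "(\<Sum>j<m. w $ j * poly Q (p j)) = (\<Sum>j<m. if j = l then w $ l * poly Q (p l) else 0)"
      by (rule sum.cong) (auto simp: Q_def poly_prod)
    then have "w $ l * poly Q (p l) = 0" using poly[of Q] l by simp
    moreover have "poly Q (p l) \<noteq> 0"
      using inj l by (auto simp: Q_def poly_prod inj_on_def)
    ultimately show ?thesis by simp
  qed
  then have "w = 0\<^sub>v m" using w(1) by (intro eq_vecI) auto
  with w(2) show False by simp
qed

section \<open>An explicit basis of solutions\<close>

primrec rec_inv :: "(nat \<Rightarrow> 'a) \<Rightarrow> (nat \<Rightarrow> 'a) \<Rightarrow> nat \<Rightarrow> 'a::comm_ring_1" where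
  "rec_inv z f 0 = f 0"
| "rec_inv z f (Suc N) = f (Suc N) + z (Suc N) * rec_inv z f N"

lemma rec_op_rec_inv: "rec_op z (rec_inv z f) = f"
  by (auto simp: fun_eq_iff rec_op_def split: nat.split)

lemma rec_inv_leading:
  assumes "\<And>K. K < N \<Longrightarrow> f K = 0"
  shows "K < N \<Longrightarrow> rec_inv z f K = 0" and "rec_inv z f N = f N"
proof -
  show *: "K < N \<Longrightarrow> rec_inv z f K = 0" for K
    using assms by (induction K) auto
  show "rec_inv z f N = f N" using * by (cases N) auto
qed

text \<open>Generating functions of weakly increasing words in the letters \<open>j + 1, \<dots>, v\<close>, whose first
  letter has position \<open>M - j\<close>.\<close>

primrec word_sum :: "nat \<Rightarrow> (nat \<Rightarrow> nat \<Rightarrow> 'a) \<Rightarrow> nat \<Rightarrow> nat \<Rightarrow> nat \<Rightarrow> 'a::comm_ring_1" where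
  "word_sum M zs 0 j = (\<lambda>N. if N = M - 1 - j then 1 else 0)"
| "word_sum M zs (Suc v) j = (if j \<le> v then rec_inv (zs (Suc v)) (word_sum M zs v j) else word_sum M zs v j)"

lemma word_sum_no_letters: "v \<le> j \<Longrightarrow> word_sum M zs v j N = (if N = M - 1 - j then 1 else 0)"
  by (induction v) auto

lemma word_sum_leading:
  "N < M - 1 - j \<Longrightarrow> word_sum M zs v j N = 0" "word_sum M zs v j (M - 1 - j) = 1"
proof -
  have "(\<forall>N < M - 1 - j. word_sum M zs v j N = 0) \<and> word_sum M zs v j (M - 1 - j) = 1"
    by (induction v) (auto simp: rec_inv_leading)
  then show "N < M - 1 - j \<Longrightarrow> word_sum M zs v j N = 0" "word_sum M zs v j (M - 1 - j) = 1" by auto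
qed

text \<open>The operators of the letters \<open>m, ..., j + 1\<close> undo the inverses one by one.
  What remains is \<open>j\<close> operators on the unit sequence at \<open>m - 1 - j\<close>, whose
  support ends by index \<open>m - 1\<close>.\<close>

lemma rec_solution_word_sum:
  assumes "j < m"
  shows "rec_solution zs m (word_sum m zs m j)"
proof -
  have "rec_ops zs v (word_sum m zs v j) = rec_ops zs j (word_sum m zs j j)" if "j \<le> v" for v
    using that by (induction v rule: dec_induct) (simp_all add: rec_op_rec_inv)
  from this[of m] show ?thesis
    using assms by (auto simp: rec_solution_def word_sum_no_letters intro!: rec_ops_support[of "m - 1 - j"])
qed

section \<open>Branching of determinants and of tableaux\<close>

text \<open>The recurrence unrolled from \<open>N\<close> down to \<open>K\<close>. The first term
  is the multiple of a lower row that the row operations in \<open>det_word_sum_branching\<close>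
  remove.\<close>

lemma rec_inv_interval:
  assumes "K \<le> N"
  shows "rec_inv z f N = (\<Prod>t\<in>{K<..N}. z t) * rec_inv z f K + (\<Sum>L\<in>{K<..N}. (\<Prod>t\<in>{L<..N}. z t) * f L)"
  using assms
proof (induction N rule: dec_induct)
  case (step N)
  have ins: "{L<..Suc N} = insert (Suc N) {L<..N}" if "L \<le> N" for L using that by auto
  have "(\<Sum>L\<in>{K<..Suc N}. (\<Prod>t\<in>{L<..Suc N}. z t) * f L)
    = f (Suc N) + (\<Sum>L\<in>{K<..N}. (\<Prod>t\<in>{L<..Suc N}. z t) * f L)"
    using step by (simp add: ins)
  also have "(\<Sum>L\<in>{K<..N}. (\<Prod>t\<in>{L<..Suc N}. z t) * f L)
    = z (Suc N) * (\<Sum>L\<in>{K<..N}. (\<Prod>t\<in>{L<..N}. z t) * f L)"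
    unfolding sum_distrib_left by (rule sum.cong) (auto simp: ins mult_ac)
  finally show ?case using step by (simp add: ins algebra_simps)
qed simp

text \<open>Multilinearity in the rows: \<mu> selects the summand taken from each row.\<close>

lemma det_sum_rows:
  fixes F :: "nat \<Rightarrow> nat \<Rightarrow> nat \<Rightarrow> 'a::comm_ring_1"
  assumes S: "\<And>i. i \<in> {1..v} \<Longrightarrow> finite (S i)"
  shows "det (mat v v (\<lambda>(i, j). \<Sum>k\<in>S (Suc i). w (Suc i) k * F (Suc i) j k)) =
    (\<Sum>\<mu>\<in>Pi\<^sub>E {1..v} S. (\<Prod>i=1..v. w i (\<mu> i)) * det (mat v v (\<lambda>(i, j). F (Suc i) j (\<mu> (Suc i)))))"
proof -
  let ?P = "{p. p permutes {0..<v}}"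
  have shift: "(\<Prod>i = 0..<v. h (Suc i)) = (\<Prod>i=1..v. h i)" for h :: "nat \<Rightarrow> 'a"
    by (rule prod.reindex_bij_witness[of _ "\<lambda>k. k - 1" Suc]) auto
  have entry: "(\<Prod>i = 0..<v. \<Sum>k\<in>S (Suc i). w (Suc i) k * F (Suc i) (p i) k) =
    (\<Sum>\<mu>\<in>Pi\<^sub>E {1..v} S. (\<Prod>i=1..v. w i (\<mu> i)) * (\<Prod>i = 0..<v. F (Suc i) (p i) (\<mu> (Suc i))))" for p
  proof -
    have "(\<Prod>i = 0..<v. \<Sum>k\<in>S (Suc i). w (Suc i) k * F (Suc i) (p i) k) =
      (\<Prod>i=1..v. \<Sum>k\<in>S i. w i k * F i (p (i - 1)) k)"
      using shift[of "\<lambda>i. \<Sum>k\<in>S i. w i k * F i (p (i - 1)) k"] by simp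
    also have "\<dots> = (\<Sum>\<mu>\<in>Pi\<^sub>E {1..v} S. \<Prod>i=1..v. w i (\<mu> i) * F i (p (i - 1)) (\<mu> i))"
      by (rule prod_sum_PiE) (use S in auto)
    also have "\<dots> = (\<Sum>\<mu>\<in>Pi\<^sub>E {1..v} S. (\<Prod>i=1..v. w i (\<mu> i)) * (\<Prod>i = 0..<v. F (Suc i) (p i) (\<mu> (Suc i))))"
      using shift[of "\<lambda>i. F i (p (i - 1)) (\<mu> i)" for \<mu>] by (simp add: prod.distrib)
    finally show ?thesis .
  qed
  have perm: "p i < v" if "p permutes {0..<v}" "i < v" for p i
    using permutes_in_image[OF that(1), of i] that(2) by simp
  have "det (mat v v (\<lambda>(i, j). \<Sum>k\<in>S (Suc i). w (Suc i) k * F (Suc i) j k)) =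
    (\<Sum>p\<in>?P. signof p * (\<Prod>i = 0..<v. \<Sum>k\<in>S (Suc i). w (Suc i) k * F (Suc i) (p i) k))"
    by (subst det_def'[of _ v]) (auto intro!: sum.cong prod.cong arg_cong2[of _ _ _ _ "(*)"] simp: perm)
  also have "\<dots> = (\<Sum>\<mu>\<in>Pi\<^sub>E {1..v} S. \<Sum>p\<in>?P. (\<Prod>i=1..v. w i (\<mu> i)) *
      (signof p * (\<Prod>i = 0..<v. F (Suc i) (p i) (\<mu> (Suc i)))))"
    unfolding entry sum_distrib_left by (subst sum.swap) (simp add: mult_ac)
  also have "\<dots> = (\<Sum>\<mu>\<in>Pi\<^sub>E {1..v} S. (\<Prod>i=1..v. w i (\<mu> i)) *
      det (mat v v (\<lambda>(i, j). F (Suc i) j (\<mu> (Suc i)))))"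
    unfolding sum_distrib_left[symmetric]
    by (intro sum.cong refl arg_cong2[of _ _ _ _ "(*)"], subst det_def'[of _ v])
      (auto intro!: sum.cong prod.cong arg_cong2[of _ _ _ _ "(*)"] simp: perm)
  finally show ?thesis .
qed

lemma det_last_column:
  assumes A: "A \<in> carrier_mat (Suc v) (Suc v)" and "\<And>i. i < v \<Longrightarrow> A $$ (i, v) = 0"
  shows "det (A :: 'a::comm_ring_1 mat) = A $$ (v, v) * det (mat v v (\<lambda>(i, j). A $$ (i, j)))"
proof -
  have "mat_delete A v v = mat v v (\<lambda>(i, j). A $$ (i, j))"
    using A by (intro eq_matI) (auto simp: mat_delete_def)
  then show ?thesis
    using laplace_expansion_column[OF A, of v] assms(2) by (simp add: cofactor_def flip: mult_2)
qed

text \<open>Subtracting a multiple of the next row truncates the expansion in the letter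
  \<open>Suc v\<close> to an interval between consecutive parts. Multilinearity then produces the
  interlacing \<mu>, and the last column vanishes above its bottom entry, which reduces the size by
  one.\<close>

lemma det_word_sum_branching:
  fixes zs :: "nat \<Rightarrow> nat \<Rightarrow> 'a::idom"
  assumes M: "Suc v \<le> M" and lam: "\<And>i. 1 \<le> i \<Longrightarrow> i \<le> v \<Longrightarrow> lam (Suc i) \<le> lam i"
  shows "det (mat (Suc v) (Suc v) (\<lambda>(i, j). word_sum M zs (Suc v) j (lam (Suc i) + (M - Suc i)))) =
    (\<Prod>c=1..lam (Suc v). zs (Suc v) (c + (M - Suc v))) *
    (\<Sum>\<mu>\<in>Pi\<^sub>E {1..v} (\<lambda>i. {lam (Suc i)..lam i}).
      (\<Prod>i=1..v. \<Prod>c\<in>{\<mu> i<..lam i}. zs (Suc v) (c + (M - i))) *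
      det (mat v v (\<lambda>(i, j). word_sum M zs v j (\<mu> (Suc i) + (M - Suc i)))))"
proof -
  let ?z = "zs (Suc v)"
  define N where "N i = lam (Suc i) + (M - Suc i)" for i
  define A where "A = mat (Suc v) (Suc v) (\<lambda>(i, j). word_sum M zs (Suc v) j (N i))"
  \<comment> \<open>The upper bidiagonal matrix of these row operations; it has determinant
    1.\<close>
  define U where "U = mat (Suc v) (Suc v) (\<lambda>(i, k). if k = i then 1
    else if k = Suc i then - (\<Prod>t\<in>{N k<..N i}. ?z t) else 0)"
  have N_mono: "N (Suc i) < N i" if "i < v" for i
    using lam[of "Suc i"] that M by (simp add: N_def)
  have shift: "{a + d<..b + d} = (\<lambda>c. c + d) ` {a<..b}" for a b d :: nat
    by (auto simp: image_iff Bex_def) presburger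
  have inj: "inj_on (\<lambda>c. c + d) X" for d :: nat and X by (simp add: inj_on_def)
  have row: "(U * A) $$ (i, j) = (\<Sum>k\<in>{lam (Suc (Suc i))..lam (Suc i)}.
      (\<Prod>c\<in>{k<..lam (Suc i)}. ?z (c + (M - Suc i))) * word_sum M zs v j (k + (M - Suc i)))"
    if i: "i < v" and j: "j < Suc v" for i j
  proof -
    have "(U * A) $$ (i, j) = (\<Sum>k<Suc v. U $$ (i, k) * A $$ (k, j))"
      using i j by (auto simp: scalar_prod_def U_def A_def atLeast0LessThan simp del: sum.lessThan_Suc intro!: sum.cong)
    also have "\<dots> = (\<Sum>k\<in>{i, Suc i}. U $$ (i, k) * A $$ (k, j))"
      using i by (intro sum.mono_neutral_right) (auto simp: U_def)
    also have "\<dots> = word_sum M zs (Suc v) j (N i) -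
        (\<Prod>t\<in>{N (Suc i)<..N i}. ?z t) * word_sum M zs (Suc v) j (N (Suc i))"
      using i j by (simp add: U_def A_def del: word_sum.simps)
    also have "\<dots> = (\<Sum>L\<in>{N (Suc i)<..N i}. (\<Prod>t\<in>{L<..N i}. ?z t) * word_sum M zs v j L)"
      using rec_inv_interval[of "N (Suc i)" "N i" ?z "word_sum M zs v j"] N_mono[OF i] j by simp
    \<comment> \<open>The open lower end compensates for the offset \<open>M - Suc (Suc i)\<close>
      being one less than \<open>M - Suc i\<close>, so the new part may equal the next part of
      \<open>lam\<close>.\<close>
    also have "{N (Suc i)<..N i} = (\<lambda>k. k + (M - Suc i)) ` {lam (Suc (Suc i))..lam (Suc i)}"
    proof -
      have "{N (Suc i)<..N i} = {lam (Suc (Suc i)) + (M - Suc i)..lam (Suc i) + (M - Suc i)}"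
        using M i by (auto simp: N_def)
      then show ?thesis by (simp add: image_add_atLeastAtMost')
    qed
    also have "(\<Sum>L\<in>(\<lambda>k. k + (M - Suc i)) ` {lam (Suc (Suc i))..lam (Suc i)}.
        (\<Prod>t\<in>{L<..N i}. ?z t) * word_sum M zs v j L) =
      (\<Sum>k\<in>{lam (Suc (Suc i))..lam (Suc i)}.
        (\<Prod>c\<in>{k<..lam (Suc i)}. ?z (c + (M - Suc i))) * word_sum M zs v j (k + (M - Suc i)))"
      by (subst sum.reindex[OF inj]) (simp add: N_def shift prod.reindex[OF inj])
    finally show ?thesis .
  qed
  have last: "(U * A) $$ (v, j) = word_sum M zs (Suc v) j (N v)" if j: "j < Suc v" for j
  proof -
    have "(U * A) $$ (v, j) = (\<Sum>k<Suc v. U $$ (v, k) * A $$ (k, j))"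
      using j by (auto simp: scalar_prod_def U_def A_def atLeast0LessThan simp del: sum.lessThan_Suc intro!: sum.cong)
    also have "\<dots> = (\<Sum>k\<in>{v}. U $$ (v, k) * A $$ (k, j))"
      by (intro sum.mono_neutral_right) (auto simp: U_def)
    finally show ?thesis using j by (simp add: U_def A_def del: word_sum.simps)
  qed
  have UA: "U * A \<in> carrier_mat (Suc v) (Suc v)" unfolding U_def A_def by (rule mult_carrier_mat) auto
  have "det U = 1" by (rule det_unitriangular[of _ "Suc v"]) (auto simp: U_def)
  then have "det A = det (U * A)"
    by (subst det_mult[of _ "Suc v"]) (auto simp: U_def A_def simp del: word_sum.simps)
  also have "\<dots> = (U * A) $$ (v, v) * det (mat v v (\<lambda>(i, j). (U * A) $$ (i, j)))"
  proof (rule det_last_column[OF UA])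
    fix i assume i: "i < v"
    \<comment> \<open>With no letters left, the sequence is supported at \<open>M - 1 - v\<close>,
      strictly below the indices that occur here because \<open>i < v\<close>.\<close>
    have "word_sum M zs v v (k + (M - Suc i)) = 0" for k
      using i M by (simp add: word_sum_no_letters)
    then show "(U * A) $$ (i, v) = 0" using row[OF i] by simp
  qed
  also have "(U * A) $$ (v, v) = (\<Prod>c=1..lam (Suc v). ?z (c + (M - Suc v)))"
  proof -
    let ?K = "M - Suc v"
    have K: "?K \<le> N v" by (simp add: N_def)
    have "(\<Sum>L\<in>{?K<..N v}. (\<Prod>t\<in>{L<..N v}. ?z t) * word_sum M zs v v L) = 0"
      by (intro sum.neutral) (auto simp: word_sum_no_letters)
    moreover have "rec_inv ?z (word_sum M zs v v) ?K = 1"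
      by (subst rec_inv_leading(2)) (auto simp: word_sum_no_letters)
    ultimately have "word_sum M zs (Suc v) v (N v) = (\<Prod>t\<in>{?K<..N v}. ?z t)"
      using rec_inv_interval[OF K, of ?z "word_sum M zs v v"] by simp
    also have "\<dots> = (\<Prod>c\<in>{0<..lam (Suc v)}. ?z (c + ?K))"
      using shift[of 0 ?K "lam (Suc v)"] by (simp add: N_def prod.reindex[OF inj])
    also have "{0<..lam (Suc v)} = {1..lam (Suc v)}" by auto
    finally show ?thesis by (simp add: last)
  qed
  also have "mat v v (\<lambda>(i, j). (U * A) $$ (i, j)) = mat v v (\<lambda>(i, j). \<Sum>k\<in>{lam (Suc (Suc i))..lam (Suc i)}.
      (\<Prod>c\<in>{k<..lam (Suc i)}. ?z (c + (M - Suc i))) * word_sum M zs v j (k + (M - Suc i)))"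
    using row by (intro eq_matI) (auto simp del: index_mult_mat)
  also have "det \<dots> = (\<Sum>\<mu>\<in>Pi\<^sub>E {1..v} (\<lambda>i. {lam (Suc i)..lam i}).
      (\<Prod>i=1..v. \<Prod>c\<in>{\<mu> i<..lam i}. ?z (c + (M - i))) *
      det (mat v v (\<lambda>(i, j). word_sum M zs v j (\<mu> (Suc i) + (M - Suc i)))))"
    by (rule det_sum_rows[where S = "\<lambda>i. {lam (Suc i)..lam i}"
          and w = "\<lambda>i k. \<Prod>c\<in>{k<..lam i}. ?z (c + (M - i))"
          and F = "\<lambda>i j k. word_sum M zs v j (k + (M - i))"]) simp
  finally show ?thesis unfolding A_def N_def .
qed

section \<open>Removing the largest entries of a tableau\<close>

definition sub_shape :: "nat \<Rightarrow> (nat \<Rightarrow> nat) \<Rightarrow> (nat \<times> nat \<Rightarrow> nat) \<Rightarrow> nat \<Rightarrow> nat" where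
  "sub_shape v lam T = (\<lambda>i\<in>{1..v}. Max (insert 0 {c \<in> {1..lam i}. T (i, c) \<le> v}))"

definition extend_tableau :: "nat \<Rightarrow> (nat \<Rightarrow> nat) \<Rightarrow> (nat \<Rightarrow> nat) \<Rightarrow> (nat \<times> nat \<Rightarrow> nat) \<Rightarrow> nat \<times> nat \<Rightarrow> nat" where
  "extend_tableau v lam \<mu> T = (\<lambda>b\<in>young_diagram (Suc v) lam. if b \<in> young_diagram v \<mu> then T b else Suc v)"

locale tableau_branching =
  fixes v :: nat and lam :: "nat \<Rightarrow> nat"
  assumes lam: "\<And>i. 1 \<le> i \<Longrightarrow> i \<le> v \<Longrightarrow> lam (Suc i) \<le> lam i"
begin

abbreviation "D \<equiv> young_diagram (Suc v) lam"
abbreviation "shapes \<equiv> Pi\<^sub>E {1..v} (\<lambda>i. {lam (Suc i)..lam i})"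

lemma lam_mono: "i \<le> k \<Longrightarrow> 1 \<le> i \<Longrightarrow> k \<le> Suc v \<Longrightarrow> lam k \<le> lam i"
proof (induction k rule: dec_induct)
  case (step k)
  then show ?case using lam[of k] by simp
qed simp

lemma shapes_bounds: "\<mu> \<in> shapes \<Longrightarrow> 1 \<le> i \<Longrightarrow> i \<le> v \<Longrightarrow> lam (Suc i) \<le> \<mu> i \<and> \<mu> i \<le> lam i"
  using PiE_mem[of \<mu> "{1..v}" _ i] by fastforce

lemma young_diagram_shape_subset: "\<mu> \<in> shapes \<Longrightarrow> young_diagram v \<mu> \<subseteq> D"
  using shapes_bounds[of \<mu>] by (fastforce simp: young_diagram_def intro: order_trans)

lemma ssytD:
  assumes "T \<in> ssyt w \<mu>"
  shows "T \<in> young_diagram w \<mu> \<rightarrow>\<^sub>E {1..w}"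
    and "(i, c) \<in> young_diagram w \<mu> \<Longrightarrow> (i, c') \<in> young_diagram w \<mu> \<Longrightarrow> c \<le> c' \<Longrightarrow> T (i, c) \<le> T (i, c')"
    and "(i, c) \<in> young_diagram w \<mu> \<Longrightarrow> (i', c) \<in> young_diagram w \<mu> \<Longrightarrow> i < i' \<Longrightarrow> T (i, c) < T (i', c)"
proof -
  show "T \<in> young_diagram w \<mu> \<rightarrow>\<^sub>E {1..w}" using assms by (simp add: ssyt_def)
  show "(i, c) \<in> young_diagram w \<mu> \<Longrightarrow> (i, c') \<in> young_diagram w \<mu> \<Longrightarrow> c \<le> c' \<Longrightarrow> T (i, c) \<le> T (i, c')"
    using assms by (cases "c = c'") (simp_all add: ssyt_def)
  show "(i, c) \<in> young_diagram w \<mu> \<Longrightarrow> (i', c) \<in> young_diagram w \<mu> \<Longrightarrow> i < i' \<Longrightarrow> T (i, c) < T (i', c)"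
    using assms unfolding ssyt_def by blast
qed

text \<open>Rows increase weakly, so the entries at most \<open>v\<close> fill an initial segment of
  each row; the maximum in \<open>sub_shape\<close> is its length.\<close>

lemma le_sub_shape_iff:
  assumes T: "T \<in> ssyt (Suc v) lam" and b: "(i, c) \<in> D" "i \<le> v"
  shows "c \<le> sub_shape v lam T i \<longleftrightarrow> T (i, c) \<le> v"
proof -
  let ?S = "insert 0 {c \<in> {1..lam i}. T (i, c) \<le> v}"
  have i: "1 \<le> i" "1 \<le> c" "c \<le> lam i" using b by (auto simp: young_diagram_def)
  have sh: "sub_shape v lam T i = Max ?S" using i b by (simp add: sub_shape_def)
  have fin: "finite ?S" by simp
  show ?thesis
  proof
    assume "T (i, c) \<le> v"
    then have "c \<in> ?S" using i by auto
    then show "c \<le> sub_shape v lam T i" unfolding sh using fin by (rule Max_ge[rotated])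
  next
    assume c: "c \<le> sub_shape v lam T i"
    have "Max ?S \<in> ?S" using fin by (rule Max_in) simp
    then have m: "Max ?S \<in> {1..lam i}" "T (i, Max ?S) \<le> v" using c i unfolding sh by auto
    have "(i, Max ?S) \<in> D" using m(1) i b(2) unfolding young_diagram_def by auto
    then have "T (i, c) \<le> T (i, Max ?S)" using ssytD(2)[OF T b(1)] c unfolding sh by blast
    then show "T (i, c) \<le> v" using m(2) by simp
  qed
qed

text \<open>Strict increase down the columns. It forces every entry in row \<open>Suc v\<close> to
  be \<open>Suc v\<close>, as needed to recover a tableau from its restriction.\<close>

lemma entry_ge_row:
  assumes T: "T \<in> ssyt (Suc v) lam"
  shows "(i, c) \<in> D \<Longrightarrow> i \<le> T (i, c)"
proof (induction i)
  case (Suc i)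
  show ?case
  proof (cases "i = 0")
    case True
    then show ?thesis using PiE_mem[OF ssytD(1)[OF T] Suc.prems] by simp
  next
    case False
    then have "(i, c) \<in> D" using Suc.prems lam[of i] by (auto simp: young_diagram_def)
    then show ?thesis using Suc.IH ssytD(3)[OF T _ Suc.prems] by force
  qed
qed simp

lemma entry_le: "T \<in> ssyt (Suc v) lam \<Longrightarrow> b \<in> D \<Longrightarrow> T b \<le> Suc v"
  using PiE_mem[OF ssytD(1)] by fastforce

text \<open>Interlacing: a box with another box directly below it has an entry less than
  \<open>Suc v\<close>, so row \<open>i\<close> keeps at least \<open>lam (Suc i)\<close>
  boxes.\<close>

lemma sub_shape_in_shapes:
  assumes T: "T \<in> ssyt (Suc v) lam"
  shows "sub_shape v lam T \<in> shapes"
proof -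
  have "lam (Suc i) \<le> sub_shape v lam T i \<and> sub_shape v lam T i \<le> lam i" if i: "1 \<le> i" "i \<le> v" for i
  proof
    show "lam (Suc i) \<le> sub_shape v lam T i"
    proof (cases "lam (Suc i) = 0")
      case False
      let ?c = "lam (Suc i)"
      have b: "(i, ?c) \<in> D" "(Suc i, ?c) \<in> D" using False i lam[of i] by (auto simp: young_diagram_def)
      then have "T (i, ?c) \<le> v" using ssytD(3)[OF T b] entry_le[OF T b(2)] by simp
      then show ?thesis using le_sub_shape_iff[OF T b(1)] i by simp
    qed simp
    show "sub_shape v lam T i \<le> lam i" using i by (simp add: sub_shape_def)
  qed
  then show ?thesis by (auto simp: PiE_iff sub_shape_def)
qed

lemma restrict_tableau:
  assumes T: "T \<in> ssyt (Suc v) lam" and \<mu>: "\<mu> = sub_shape v lam T"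
  shows "restrict T (young_diagram v \<mu>) \<in> ssyt v \<mu>"
proof -
  have sub: "young_diagram v \<mu> \<subseteq> D"
    unfolding \<mu> by (intro young_diagram_shape_subset sub_shape_in_shapes T)
  have "T b \<in> {1..v}" if b: "b \<in> young_diagram v \<mu>" for b
  proof -
    obtain i c where ic: "b = (i, c)" by (cases b)
    then have "i \<le> v" "c \<le> sub_shape v lam T i" using b by (auto simp: young_diagram_def \<mu>)
    then have "T b \<le> v" using le_sub_shape_iff[OF T, of i c] sub b ic by auto
    moreover have "1 \<le> T b" using PiE_mem[OF ssytD(1)[OF T] subsetD[OF sub b]] by simp
    ultimately show ?thesis by simp
  qed
  then show ?thesis
    unfolding ssyt_def using ssytD(2,3)[OF T] sub by (auto simp: subset_iff)
qed

text \<open>By interlacing the added boxes form a horizontal strip. Thus the upper of two boxes in a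
  column always lies in the smaller diagram, and strictness survives.\<close>

lemma extend_tableau_in_ssyt:
  assumes \<mu>: "\<mu> \<in> shapes" and T: "T \<in> ssyt v \<mu>"
  shows "extend_tableau v lam \<mu> T \<in> ssyt (Suc v) lam"
proof -
  let ?E = "extend_tableau v lam \<mu> T" and ?Y = "young_diagram v \<mu>"
  have TY: "1 \<le> T b \<and> T b \<le> v" if "b \<in> ?Y" for b using PiE_mem[OF ssytD(1)[OF T] that] by simp
  have E: "?E b = (if b \<in> ?Y then T b else Suc v)" if "b \<in> D" for b
    using that by (simp add: extend_tableau_def)
  have "?E \<in> D \<rightarrow>\<^sub>E {1..Suc v}"
  proof (rule PiE_I)
    show "?E b \<in> {1..Suc v}" if "b \<in> D" for b using TY[of b] E[OF that] by auto
  qed (simp add: extend_tableau_def)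
  moreover have "?E (i, c) \<le> ?E (i, c')" if "(i, c) \<in> D" "(i, c') \<in> D" "c < c'" for i c c'
  proof (cases "(i, c') \<in> ?Y")
    case True
    then have "(i, c) \<in> ?Y" using that by (auto simp: young_diagram_def)
    then show ?thesis using True ssytD(2)[OF T] that by (simp add: E)
  next
    case False
    then show ?thesis using that TY[of "(i, c)"] by (auto simp: E)
  qed
  moreover have "?E (i, c) < ?E (i', c)" if b: "(i, c) \<in> D" "(i', c) \<in> D" "i < i'" for i i' c
  proof -
    have ii: "1 \<le> i" "i \<le> v" "i' \<le> Suc v" "1 \<le> c" using b by (auto simp: young_diagram_def)
    have "c \<le> lam i'" using b by (simp add: young_diagram_def)
    also have "\<dots> \<le> lam (Suc i)" using lam_mono[of "Suc i" i'] b ii by simp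
    also have "\<dots> \<le> \<mu> i" using shapes_bounds[OF \<mu>] ii by simp
    finally have Y: "(i, c) \<in> ?Y" using ii by (simp add: young_diagram_def)
    show ?thesis
      using b Y TY[OF Y] ssytD(3)[OF T Y] by (auto simp: E)
  qed
  ultimately show ?thesis by (auto simp: ssyt_def)
qed

lemma sub_shape_extend_tableau:
  assumes \<mu>: "\<mu> \<in> shapes" and T: "T \<in> ssyt v \<mu>"
  shows "sub_shape v lam (extend_tableau v lam \<mu> T) = \<mu>"
proof
  fix i
  show "sub_shape v lam (extend_tableau v lam \<mu> T) i = \<mu> i"
  proof (cases "i \<in> {1..v}")
    case True
    have TY: "T b \<le> v" if "b \<in> young_diagram v \<mu>" for b using PiE_mem[OF ssytD(1)[OF T] that] by simp
    have "{c \<in> {1..lam i}. extend_tableau v lam \<mu> T (i, c) \<le> v} = {1..\<mu> i}"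
    proof -
      have "extend_tableau v lam \<mu> T (i, c) \<le> v \<longleftrightarrow> c \<le> \<mu> i" if "c \<in> {1..lam i}" for c
      proof -
        have "(i, c) \<in> D" "(i, c) \<in> young_diagram v \<mu> \<longleftrightarrow> c \<le> \<mu> i"
          using that True by (auto simp: young_diagram_def)
        then show ?thesis using TY[of "(i, c)"] by (auto simp: extend_tableau_def)
      qed
      then show ?thesis using shapes_bounds[OF \<mu>, of i] True by auto
    qed
    moreover have "Max (insert 0 {1..\<mu> i}) = \<mu> i"
      by (rule Max_eqI) auto
    ultimately show ?thesis using True by (simp add: sub_shape_def)
  next
    case False
    then show ?thesis using \<mu> by (auto simp: sub_shape_def PiE_iff extensional_def)
  qed
qed

lemma restrict_extend_tableau:
  assumes \<mu>: "\<mu> \<in> shapes" and T: "T \<in> ssyt v \<mu>"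
  shows "restrict (extend_tableau v lam \<mu> T) (young_diagram v \<mu>) = T"
proof
  fix b
  show "restrict (extend_tableau v lam \<mu> T) (young_diagram v \<mu>) b = T b"
    using subsetD[OF young_diagram_shape_subset[OF \<mu>], of b] PiE_arb[OF ssytD(1)[OF T], of b]
    by (cases "b \<in> young_diagram v \<mu>") (simp_all add: extend_tableau_def)
qed

lemma extend_restrict_tableau:
  assumes T: "T \<in> ssyt (Suc v) lam" and \<mu>: "\<mu> = sub_shape v lam T"
  shows "extend_tableau v lam \<mu> (restrict T (young_diagram v \<mu>)) = T"
proof
  fix b
  show "extend_tableau v lam \<mu> (restrict T (young_diagram v \<mu>)) b = T b"
  proof (cases "b \<in> D \<and> b \<notin> young_diagram v \<mu>")
    case True
    obtain i c where ic: "b = (i, c)" by (cases b)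
    have "T b \<ge> Suc v"
    proof (cases "i \<le> v")
      case iv: True
      then have "\<not> c \<le> sub_shape v lam T i" using True ic by (auto simp: young_diagram_def \<mu>)
      then show ?thesis using le_sub_shape_iff[OF T, of i c] True ic iv by simp
    next
      case False
      then show ?thesis using entry_ge_row[OF T, of i c] True ic by simp
    qed
    then show ?thesis using True entry_le[OF T, of b] by (simp add: extend_tableau_def)
  next
    case False
    then show ?thesis using PiE_arb[OF ssytD(1)[OF T], of b] by (auto simp: extend_tableau_def)
  qed
qed

lemma prod_extend_tableau:
  fixes x :: "nat \<Rightarrow> nat \<times> nat \<Rightarrow> 'a::comm_monoid_mult"
  assumes \<mu>: "\<mu> \<in> shapes"
  shows "(\<Prod>b\<in>D. x (extend_tableau v lam \<mu> T b) b) =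
    (\<Prod>c=1..lam (Suc v). x (Suc v) (Suc v, c)) * (\<Prod>i=1..v. \<Prod>c\<in>{\<mu> i<..lam i}. x (Suc v) (i, c)) *
    (\<Prod>b\<in>young_diagram v \<mu>. x (T b) b)"
proof -
  let ?Y = "young_diagram v \<mu>"
  \<comment> \<open>The smaller diagram has only \<open>v\<close> rows, so the whole of row
    \<open>Suc v\<close> is added.\<close>
  let ?C = "\<lambda>i. if i = Suc v then {1..lam i} else {\<mu> i<..lam i}"
  have sub: "?Y \<subseteq> D" by (rule young_diagram_shape_subset[OF \<mu>])
  have fin: "finite D"
    by (rule finite_subset[of _ "Sigma {1..Suc v} (\<lambda>i. {1..lam i})"]) (auto simp: young_diagram_def)
  have diff: "D - ?Y = Sigma {1..Suc v} ?C"
    by (auto simp: young_diagram_def le_Suc_eq split: if_splits)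
  have "(\<Prod>b\<in>D. x (extend_tableau v lam \<mu> T b) b) =
    (\<Prod>b\<in>D - ?Y. x (extend_tableau v lam \<mu> T b) b) * (\<Prod>b\<in>?Y. x (extend_tableau v lam \<mu> T b) b)"
    by (rule prod.subset_diff[OF sub fin])
  also have "(\<Prod>b\<in>?Y. x (extend_tableau v lam \<mu> T b) b) = (\<Prod>b\<in>?Y. x (T b) b)"
    using sub by (intro prod.cong) (auto simp: extend_tableau_def)
  also have "(\<Prod>b\<in>D - ?Y. x (extend_tableau v lam \<mu> T b) b) = (\<Prod>b\<in>D - ?Y. x (Suc v) b)"
    by (intro prod.cong) (auto simp: extend_tableau_def)
  also have "\<dots> = (\<Prod>i=1..Suc v. \<Prod>c\<in>?C i. x (Suc v) (i, c))"
    unfolding diff by (subst prod.Sigma) auto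
  also have "\<dots> = (\<Prod>c=1..lam (Suc v). x (Suc v) (Suc v, c)) * (\<Prod>i=1..v. \<Prod>c\<in>{\<mu> i<..lam i}. x (Suc v) (i, c))"
    by (simp add: prod.nat_ivl_Suc' mult.commute)
  finally show ?thesis .
qed

end

lemma finite_ssyt: "finite (ssyt v lam)"
proof -
  have "finite (young_diagram v lam)"
    by (rule finite_subset[of _ "Sigma {1..v} (\<lambda>i. {1..lam i})"]) (auto simp: young_diagram_def)
  then have "finite (young_diagram v lam \<rightarrow>\<^sub>E {1..v})" by (intro finite_PiE) auto
  then show ?thesis by (rule finite_subset[rotated]) (auto simp: ssyt_def)
qed

text \<open>Tableaux are grouped by the shape left after deleting the entries \<open>Suc v\<close>;
  the deleted strip contributes the explicit products.\<close>

lemma loop_schur_branching: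
  assumes "\<And>i. 1 \<le> i \<Longrightarrow> i \<le> v \<Longrightarrow> lam (Suc i) \<le> lam i"
  shows "loop_schur (Suc v) n lam r =
    (\<Prod>c=1..lam (Suc v). loop_var n (Suc v) (r + int (Suc v) - int c)) *
    (\<Sum>\<mu>\<in>Pi\<^sub>E {1..v} (\<lambda>i. {lam (Suc i)..lam i}).
      (\<Prod>i=1..v. \<Prod>c\<in>{\<mu> i<..lam i}. loop_var n (Suc v) (r + int i - int c)) * loop_schur v n \<mu> r)"
proof -
  interpret tableau_branching v lam by unfold_locales fact
  define x where "x t b = loop_var n t (r + int (fst b) - int (snd b))" for t b
  define Sh where "Sh = shapes"
  note Sh = sub_shape_in_shapes[folded Sh_def] sub_shape_extend_tableau[folded Sh_def]
    restrict_extend_tableau[folded Sh_def] extend_tableau_in_ssyt[folded Sh_def]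
  have schur: "loop_schur w n \<mu> r = (\<Sum>T\<in>ssyt w \<mu>. \<Prod>b\<in>young_diagram w \<mu>. x (T b) b)" for w \<mu>
    unfolding loop_schur_def x_def by (intro sum.cong prod.cong) auto
  have "loop_schur (Suc v) n lam r = (\<Sum>(\<mu>, T)\<in>Sigma Sh (ssyt v). \<Prod>b\<in>D. x (extend_tableau v lam \<mu> T b) b)"
    unfolding schur
    by (rule sum.reindex_bij_witness[where j = "\<lambda>T. (sub_shape v lam T, restrict T (young_diagram v (sub_shape v lam T)))"
          and i = "\<lambda>(\<mu>, T). extend_tableau v lam \<mu> T"])
      (auto simp: extend_restrict_tableau restrict_tableau Sh)
  also have "\<dots> = (\<Sum>\<mu>\<in>shapes. \<Sum>T\<in>ssyt v \<mu>. \<Prod>b\<in>D. x (extend_tableau v lam \<mu> T b) b)"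
    unfolding Sh_def by (subst sum.Sigma) (auto simp: finite_ssyt intro!: finite_PiE)
  also have "\<dots> = (\<Sum>\<mu>\<in>shapes. (\<Prod>c=1..lam (Suc v). x (Suc v) (Suc v, c)) *
      ((\<Prod>i=1..v. \<Prod>c\<in>{\<mu> i<..lam i}. x (Suc v) (i, c)) * loop_schur v n \<mu> r))"
    by (intro sum.cong refl) (simp add: prod_extend_tableau schur sum_distrib_left mult.assoc)
  finally show ?thesis by (simp add: x_def sum_distrib_left)
qed

text \<open>Induction on \<open>v\<close>: both sides obey the same branching over interlacing
  shapes. \<open>M\<close> stays fixed while rows and letters are removed, since the offsets
  \<open>M - i\<close> tie positions to colours.\<close>

lemma loop_schur_eq_det:
  assumes "v \<le> M" and "\<And>i. 1 \<le> i \<Longrightarrow> i < v \<Longrightarrow> lam (Suc i) \<le> lam i"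
  shows "loop_schur v n lam r = det (mat v v (\<lambda>(i, j).
    word_sum M (\<lambda>k N. loop_var n k (r + int M - int N)) v j (lam (Suc i) + (M - Suc i))))"
  using assms
proof (induction v arbitrary: lam)
  case 0
  have "young_diagram 0 lam = {}" by (auto simp: young_diagram_def)
  then have "loop_schur 0 n lam r = 1" by (simp add: loop_schur_def ssyt_def)
  then show ?case by simp
next
  case (Suc v)
  let ?zs = "\<lambda>k N. loop_var n k (r + int M - int N)"
  have lam: "lam (Suc i) \<le> lam i" if "1 \<le> i" "i \<le> v" for i using Suc.prems(2) that by simp
  \<comment> \<open>Position \<open>c + (M - i)\<close> carries exactly the colour of the box in row
    \<open>i\<close> and column \<open>c\<close>.\<close>
  have color: "?zs k (c + (M - i)) = loop_var n k (r + int i - int c)" if "i \<le> Suc v" for k c i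
    using that Suc.prems(1) by (simp add: of_nat_diff algebra_simps)
  have IH: "loop_schur v n \<mu> r = det (mat v v (\<lambda>(i, j). word_sum M ?zs v j (\<mu> (Suc i) + (M - Suc i))))"
    if "\<mu> \<in> Pi\<^sub>E {1..v} (\<lambda>i. {lam (Suc i)..lam i})" for \<mu>
  proof (rule Suc.IH)
    fix i assume "1 \<le> i" "i < v"
    then show "\<mu> (Suc i) \<le> \<mu> i" using PiE_mem[OF that, of "Suc i"] PiE_mem[OF that, of i] by simp
  qed (use Suc.prems in simp)
  have "loop_schur (Suc v) n lam r = (\<Prod>c=1..lam (Suc v). loop_var n (Suc v) (r + int (Suc v) - int c)) *
    (\<Sum>\<mu>\<in>Pi\<^sub>E {1..v} (\<lambda>i. {lam (Suc i)..lam i}).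
      (\<Prod>i=1..v. \<Prod>c\<in>{\<mu> i<..lam i}. loop_var n (Suc v) (r + int i - int c)) * loop_schur v n \<mu> r)"
    by (rule loop_schur_branching) (rule lam)
  also have "\<dots> = (\<Prod>c=1..lam (Suc v). ?zs (Suc v) (c + (M - Suc v))) *
    (\<Sum>\<mu>\<in>Pi\<^sub>E {1..v} (\<lambda>i. {lam (Suc i)..lam i}).
      (\<Prod>i=1..v. \<Prod>c\<in>{\<mu> i<..lam i}. ?zs (Suc v) (c + (M - i))) *
      det (mat v v (\<lambda>(i, j). word_sum M ?zs v j (\<mu> (Suc i) + (M - Suc i)))))"
    by (intro arg_cong2[of _ _ _ _ "(*)"] sum.cong prod.cong refl IH) (simp_all only: color atLeastAtMost_iff le_SucI order_refl)
  also have "\<dots> = det (mat (Suc v) (Suc v) (\<lambda>(i, j). word_sum M ?zs (Suc v) j (lam (Suc i) + (M - Suc i))))"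
    by (rule det_word_sum_branching[symmetric]) (use Suc.prems(1) lam in auto)
  finally show ?case .
qed

section \<open>The ratio of alternants\<close>

lemma adj_word_perm_append: "adj_word_perm (u @ w) = adj_word_perm u \<circ> adj_word_perm w"
  by (induction u) (simp_all add: adj_word_perm_def comp_assoc)

lemma adj_word_act_append: "adj_word_act n (u @ w) = adj_word_act n u \<circ> adj_word_act n w"
  by (induction u) (simp_all add: adj_word_act_def comp_assoc)

text \<open>Conjugating the transposition of \<open>a\<close> and \<open>b\<close> by that of
  \<open>b\<close> and \<open>b + 1\<close> gives the one of \<open>a\<close> and
  \<open>b + 1\<close>.\<close>

lemma transpose_eq_adj_word_perm:
  assumes "a < b" "1 \<le> a" "b \<le> m"
  shows "\<exists>w. set w \<subseteq> {1..<m} \<and> adj_word_perm w = Transposition.transpose a b"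
proof -
  have "Suc a \<le> b" using assms by simp
  then show ?thesis using assms(2,3)
  proof (induction b rule: dec_induct)
    case base
    then show ?case by (intro exI[of _ "[a]"]) (simp add: adj_word_perm_def)
  next
    case (step b)
    then obtain w where w: "set w \<subseteq> {1..<m}" "adj_word_perm w = Transposition.transpose a b" by auto
    have "adj_word_perm ([b] @ w @ [b]) = Transposition.transpose a (Suc b)"
      unfolding adj_word_perm_append w(2) using step
      by (auto simp: adj_word_perm_def fun_eq_iff Transposition.transpose_def)
    then show ?case using w(1) step by (intro exI[of _ "[b] @ w @ [b]"]) auto
  qed
qed

text \<open>Exposes the word chosen in \<open>perm_act\<close>. The later arguments hold for any
  word that spells the transposition.\<close>

lemma t_act_adj_word:
  assumes "1 \<le> a" "a \<le> m"
  obtains w where "set w \<subseteq> {1..<m}" "adj_word_perm w = Transposition.transpose a m"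
    "t_act m n a m = adj_word_act n w"
proof -
  have "\<exists>w. set w \<subseteq> {1..<m} \<and> adj_word_perm w = Transposition.transpose a m"
  proof (cases "a = m")
    case True
    then show ?thesis by (intro exI[of _ "[]"]) (simp add: adj_word_perm_def)
  next
    case False
    then show ?thesis using transpose_eq_adj_word_perm[of a m m] assms by simp
  qed
  from someI_ex[OF this] show ?thesis
    using that unfolding t_act_def perm_act_def by blast
qed

context
  fixes n :: nat
  assumes n: "n \<ge> 1"
begin

lemma comm_ring_hom_adj_word_act: "comm_ring_hom (adj_word_act n w)"
proof (induction w)
  case Nil
  show ?case using comm_ring_hom_id by (simp add: adj_word_act_def id_def)
next
  case (Cons i w)
  then show ?case using comm_ring_hom_comp[OF comm_ring_hom_s_gen[OF n]]
    by (simp add: adj_word_act_def comp_def)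
qed

lemma adj_word_act_row_prod: "adj_word_act n w (row_prod n k) = row_prod n (adj_word_perm w k)"
  by (induction w) (simp_all add: adj_word_act_def adj_word_perm_def s_gen_row_prod[OF n])

text \<open>The word is peeled from the right, so the last generator acts directly on
  indeterminates. It preserves the sums and products required by \<open>rec_ops_swap\<close>, and
  the homomorphism of the remaining word transports these equations.\<close>

lemma rec_ops_adj_word_act:
  assumes "set w \<subseteq> {1..<m}"
  shows "rec_ops (\<lambda>k N. adj_word_act n w (loop_var n k (c - int N))) m f
    = rec_ops (\<lambda>k N. loop_var n k (c - int N)) m f"
  using assms
proof (induction w rule: rev_induct)
  case Nil
  show ?case by (simp add: adj_word_act_def)
next
  case (snoc i w)
  interpret act: comm_ring_hom "adj_word_act n w" by (rule comm_ring_hom_adj_word_act)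
  have eq: "adj_word_act n (w @ [i]) x = adj_word_act n w (s_gen n i x)" for x
    unfolding adj_word_act_append by (simp add: adj_word_act_def)
  have "rec_ops (\<lambda>k N. adj_word_act n (w @ [i]) (loop_var n k (c - int N))) m f
    = rec_ops (\<lambda>k N. adj_word_act n w (loop_var n k (c - int N))) m f"
  proof (rule rec_ops_swap[of i])
    show "1 \<le> i" "Suc i \<le> m" using snoc.prems by auto
  next
    fix k assume "k \<noteq> i" "k \<noteq> Suc i"
    then show "(\<lambda>N. adj_word_act n (w @ [i]) (loop_var n k (c - int N)))
      = (\<lambda>N. adj_word_act n w (loop_var n k (c - int N)))"
      by (simp add: eq s_gen_other[OF n])
  next
    fix N
    show "adj_word_act n (w @ [i]) (loop_var n i (c - int N))
        + adj_word_act n (w @ [i]) (loop_var n (Suc i) (c - int N))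
      = adj_word_act n w (loop_var n i (c - int N)) + adj_word_act n w (loop_var n (Suc i) (c - int N))"
      using s_gen_add[OF n, of i "c - int N"] by (simp add: eq flip: act.hom_add)
    show "adj_word_act n (w @ [i]) (loop_var n i (c - int (Suc N)))
        * adj_word_act n (w @ [i]) (loop_var n (Suc i) (c - int N))
      = adj_word_act n w (loop_var n i (c - int (Suc N))) * adj_word_act n w (loop_var n (Suc i) (c - int N))"
      using s_gen_mult[OF n, of i "c - int (Suc N)"] by (simp add: eq flip: act.hom_mult)
  qed
  then show ?case using snoc by simp
qed

text \<open>Any \<open>n\<close> consecutive colours run once through the cycle, wherever they
  start.\<close>

lemma prod_loop_var_power: "(\<Prod>k=1..q * n. loop_var n i (c - int k)) = row_prod n i ^ q"
proof (induction q)
  case (Suc q)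
  have "{1..Suc q * n} = {1..q * n} \<union> {q * n + 1..q * n + n}" by auto
  then have "(\<Prod>k=1..Suc q * n. loop_var n i (c - int k)) =
    (\<Prod>k=1..q * n. loop_var n i (c - int k)) * (\<Prod>k=q * n + 1..q * n + n. loop_var n i (c - int k))"
    by (simp only:) (rule prod.union_disjoint, auto)
  also have "(\<Prod>k=q * n + 1..q * n + n. loop_var n i (c - int k))
    = (\<Prod>k<n. loop_var n i ((c - int (q * n + 1)) - int k))"
    by (rule prod.reindex_bij_witness[of _ "\<lambda>k. k + (q * n + 1)" "\<lambda>k. k - (q * n + 1)"])
      (auto simp: of_nat_diff algebra_simps)
  also have "\<dots> = row_prod n i"
    unfolding row_prod_def by (rule prod_periodic_rev) (rule loop_var_periodic)
  finally show ?case unfolding Suc by (simp add: mult.commute)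
qed simp

end

theorem theorem3p1:
  fixes m n :: nat and r :: int and lam :: "nat \<Rightarrow> nat"
  assumes "m \<ge> 1" and "n \<ge> 1"
    and "\<And>i j. 1 \<le> i \<Longrightarrow> i \<le> j \<Longrightarrow> j \<le> m \<Longrightarrow> lam j \<le> lam i"
  shows "loop_schur m n lam r =
    loop_alternant m n (\<lambda>i. lam i + staircase m i) r / loop_alternant m n (staircase m) r"
proof -
  let ?c = "r + int m"
  define zs where "zs k N = loop_var n k (?c - int N)" for k N
  \<comment> \<open>Column \<open>j\<close> of the alternants as a function of the exponent;
    \<open>Suc j\<close> appears because matrix indices start at 0.\<close>
  define f where "f j N = t_act m n (Suc j) m (\<Prod>k=1..N. zs m k)" for j N
  have alt: "loop_alternant m n \<alpha> r = det (mat m m (\<lambda>(i, j). f j (\<alpha> (Suc i))))" for \<alpha>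
    by (simp add: loop_alternant_def alternant_mat_def f_def zs_def)
  have sol: "rec_solution zs m (f j)" and pow: "f j (q * n) = row_prod n (Suc j) ^ q" if j: "j < m" for j q
  proof -
    obtain w where w: "set w \<subseteq> {1..<m}" "adj_word_perm w = Transposition.transpose (Suc j) m"
      "t_act m n (Suc j) m = adj_word_act n w"
      by (rule t_act_adj_word[of "Suc j" m n]) (use j in simp_all)
    interpret act: comm_ring_hom "adj_word_act n w" by (rule comm_ring_hom_adj_word_act[OF assms(2)])
    \<comment> \<open>Column \<open>j\<close> is the geometric solution of the recurrence with the
      transported coefficients \<open>?ws\<close>; invariance identifies that recurrence with the
      original one.\<close>
    let ?ws = "\<lambda>k N. adj_word_act n w (loop_var n k (?c - int N))"
    have "f j = (\<lambda>N. \<Prod>k=1..N. ?ws m k)"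
      by (simp add: fun_eq_iff f_def w(3) act.hom_prod zs_def)
    then have "rec_solution ?ws m (f j)" using rec_solution_geometric[OF assms(1), of ?ws] by simp
    then show "rec_solution zs m (f j)"
      unfolding rec_solution_def rec_ops_adj_word_act[OF assms(2) w(1)] zs_def[abs_def] .
    show "f j (q * n) = row_prod n (Suc j) ^ q"
      unfolding f_def zs_def w(3) prod_loop_var_power[OF assms(2)]
      by (simp add: act.hom_power adj_word_act_row_prod[OF assms(2)] w(2))
  qed
  have "det (mat m m (\<lambda>(i, j). f j (m - 1 - i))) \<noteq> 0"
    by (rule det_rec_solutions_nonzero[where p = "\<lambda>j. row_prod n (Suc j)", OF sol pow])
      (auto simp: inj_on_def row_prod_eq_iff[OF assms(2)])
  then have nz: "loop_alternant m n (staircase m) r \<noteq> 0"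
    by (simp add: alt staircase_def)
  \<comment> \<open>The second determinant in \<open>det_rec_solutions\<close> is the staircase
    alternant, as \<open>m - 1 - i\<close> is \<open>staircase m (Suc i)\<close>.\<close>
  have "loop_alternant m n (\<lambda>i. lam i + staircase m i) r =
    det (mat m m (\<lambda>(i, j). word_sum m zs m j (lam (Suc i) + (m - Suc i)))) * loop_alternant m n (staircase m) r"
    unfolding alt staircase_def
    using det_rec_solutions[of m zs f "word_sum m zs m" "\<lambda>i. lam (Suc i) + (m - Suc i)", OF sol
        rec_solution_word_sum word_sum_leading]
    by simp
  also have "det (mat m m (\<lambda>(i, j). word_sum m zs m j (lam (Suc i) + (m - Suc i)))) = loop_schur m n lam r"
    unfolding zs_def[abs_def] by (rule loop_schur_eq_det[symmetric]) (use assms(3) in auto)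
  finally show ?thesis using nz by simp
qed

end
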